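(* Let $(\Omega; P_1,\ldots,P_n)$ be a countable proper colored $D$-set. Then $(\Omega; D, P_1,\ldots,P_n)$ is ultrahomogeneous if and only if $\Omega$ is dense and regular and, for every infinite sector $\Sigma$ of every splitting of $\Omega$ and for every color $i\in\{1,\ldots,n\}$, we have $\Sigma\cap P_i\neq\emptyset$.
   Context: A $D$-set is a set $\Omega$ with a quaternary relation $D$, written $D(wx;yz)$ or $wx|yz$, such that for all $w,x,y,z\in\Omega$: (D1) $D(wx;yz)\to (D(xw;yz)\wedge D(yz;wx))$; (D2) $D(wx;yz)\to\neg D(wy;xz)$; (D3) $D(wx;yz)\to\forall v\,(D(vx;yz)\vee D(wx;yv))$; (D4) $(w\neq y\wedge x\neq y)\to D(wx;yy)$. It is proper if $|\Omega|\ge 3$ and (D5) whenever $w,x,y$ are pairwise distinct there is $z\neq y$ with $D(wx;yz)$. It is dense if $|\Omega|\ge2$ and (D6) $D(wx;yz)$ implies there is $v$ with $D(vx;yz)\wedge D(wv;yz)\wedge D(wx;vz)\wedge D(wx;yv)$. A splitting of $\Omega$ is a partition of $\Omega$ into at least two parts (called sectors) such that (i) if $a,b$ lie in a part $\Sigma$ and $c,d\in\Omega\setminus\Sigma$ then $D(ab;cd)$, and (ii) if $a,b,c,d$ lie in four distinct parts then $\neg D(ab;cd)$. A sector is a member of some splitting. A node splitting is a splitting with more than two sectors. $\Omega$ is regular if all node splittings of $\Omega$ have the same cardinality. A colored $D$-set is a $D$-set together with finitely many unary predicates $P_1,\dots,P_n$ whose interpretations form a partition of $\Omega$ into nonempty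 sets; $x$ has color $i$ if $x\in P_i$. A structure is ultrahomogeneous if every isomorphism between finitely generated substructures extends to an automorphism. *)

theory Defs
  imports Main "HOL-Library.Countable_Set" "HOL-Library.Disjoint_Sets" "HOL-Library.Equipollence"
begin

definition at_least :: "nat \<Rightarrow> 'a set \<Rightarrow> bool" where
  "at_least k A \<longleftrightarrow> infinite A \<or> k \<le> card A"

text \<open>The atom \<open>D(wx;yz)\<close> is written \<open>D w x y z\<close>. Only the values of \<open>D\<close> on \<open>\<Omega>\<close> matter.\<close>

locale D_set =
  fixes \<Omega> :: "'a set" and D :: "'a \<Rightarrow> 'a \<Rightarrow> 'a \<Rightarrow> 'a \<Rightarrow> bool"
  assumes D1: "\<lbrakk>w \<in> \<Omega>; x \<in> \<Omega>; y \<in> \<Omega>; z \<in> \<Omega>; D w x y z\<rbrakk> \<Longrightarrow> D x w y z \<and> D y z w x"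
    and D2: "\<lbrakk>w \<in> \<Omega>; x \<in> \<Omega>; y \<in> \<Omega>; z \<in> \<Omega>; D w x y z\<rbrakk> \<Longrightarrow> \<not> D w y x z"
    and D3: "\<lbrakk>w \<in> \<Omega>; x \<in> \<Omega>; y \<in> \<Omega>; z \<in> \<Omega>; D w x y z\<rbrakk> \<Longrightarrow> \<forall>v\<in>\<Omega>. D v x y z \<or> D w x y v"
    and D4: "\<lbrakk>w \<in> \<Omega>; x \<in> \<Omega>; y \<in> \<Omega>; w \<noteq> y; x \<noteq> y\<rbrakk> \<Longrightarrow> D w x y y"

locale proper_D_set = D_set +
  assumes three_points: "at_least 3 \<Omega>"
    and D5: "\<lbrakk>w \<in> \<Omega>; x \<in> \<Omega>; y \<in> \<Omega>; w \<noteq> x; w \<noteq> y; x \<noteq> y\<rbrakk> \<Longrightarrow> \<exists>z\<in>\<Omega>. z \<noteq> y \<and> D w x y z"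

locale colored_D_set = D_set +
  fixes n :: nat and P :: "nat \<Rightarrow> 'a set"
  assumes colors_nonempty: "i \<in> {1..n} \<Longrightarrow> P i \<noteq> {}"
    and colors_disjoint: "disjoint_family_on P {1..n}"
    and colors_cover: "(\<Union>i\<in>{1..n}. P i) = \<Omega>"

definition dense_D :: "'a set \<Rightarrow> ('a \<Rightarrow> 'a \<Rightarrow> 'a \<Rightarrow> 'a \<Rightarrow> bool) \<Rightarrow> bool" where
  "dense_D \<Omega> D \<longleftrightarrow> at_least 2 \<Omega> \<and>
    (\<forall>w\<in>\<Omega>. \<forall>x\<in>\<Omega>. \<forall>y\<in>\<Omega>. \<forall>z\<in>\<Omega>. D w x y z \<longrightarrow>
      (\<exists>v\<in>\<Omega>. D v x y z \<and> D w v y z \<and> D w x v z \<and> D w x y v))"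

definition splitting :: "'a set \<Rightarrow> ('a \<Rightarrow> 'a \<Rightarrow> 'a \<Rightarrow> 'a \<Rightarrow> bool) \<Rightarrow> 'a set set \<Rightarrow> bool" where
  "splitting \<Omega> D \<S> \<longleftrightarrow> partition_on \<Omega> \<S> \<and> at_least 2 \<S> \<and>
    (\<forall>S\<in>\<S>. \<forall>a\<in>S. \<forall>b\<in>S. \<forall>c\<in>\<Omega> - S. \<forall>d\<in>\<Omega> - S. D a b c d) \<and>
    (\<forall>A\<in>\<S>. \<forall>B\<in>\<S>. \<forall>C\<in>\<S>. \<forall>E\<in>\<S>. distinct [A, B, C, E] \<longrightarrow>
      (\<forall>a\<in>A. \<forall>b\<in>B. \<forall>c\<in>C. \<forall>d\<in>E. \<not> D a b c d))"

definition node_splitting :: "'a set \<Rightarrow> ('a \<Rightarrow> 'a \<Rightarrow> 'a \<Rightarrow> 'a \<Rightarrow> bool) \<Rightarrow> 'a set set \<Rightarrow> bool" where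
  "node_splitting \<Omega> D \<S> \<longleftrightarrow> splitting \<Omega> D \<S> \<and> at_least 3 \<S>"

definition regular_D :: "'a set \<Rightarrow> ('a \<Rightarrow> 'a \<Rightarrow> 'a \<Rightarrow> 'a \<Rightarrow> bool) \<Rightarrow> bool" where
  "regular_D \<Omega> D \<longleftrightarrow>
    (\<forall>\<S> \<T>. node_splitting \<Omega> D \<S> \<and> node_splitting \<Omega> D \<T> \<longrightarrow> \<S> \<approx> \<T>)"

text \<open>Isomorphisms between the substructures of \<open>(\<Omega>; D, P\<^sub>1, \<dots>, P\<^sub>n)\<close> with universes \<open>A\<close> and \<open>B\<close>.\<close>

definition colored_D_iso ::
  "('a \<Rightarrow> 'a \<Rightarrow> 'a \<Rightarrow> 'a \<Rightarrow> bool) \<Rightarrow> nat \<Rightarrow> (nat \<Rightarrow> 'a set) \<Rightarrow> 'a set \<Rightarrow> 'a set \<Rightarrow> ('a \<Rightarrow> 'a) \<Rightarrow> bool" where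
  "colored_D_iso D n P A B f \<longleftrightarrow> bij_betw f A B \<and>
    (\<forall>w\<in>A. \<forall>x\<in>A. \<forall>y\<in>A. \<forall>z\<in>A. D (f w) (f x) (f y) (f z) \<longleftrightarrow> D w x y z) \<and>
    (\<forall>i\<in>{1..n}. \<forall>x\<in>A. f x \<in> P i \<longleftrightarrow> x \<in> P i)"

text \<open>The language is purely relational, so the finitely generated substructures are exactly
  those induced on the finite subsets of \<open>\<Omega>\<close>. (Admitting the empty one is harmless: the empty map
  extends to the identity.)\<close>

definition ultrahomogeneous ::
  "'a set \<Rightarrow> ('a \<Rightarrow> 'a \<Rightarrow> 'a \<Rightarrow> 'a \<Rightarrow> bool) \<Rightarrow> nat \<Rightarrow> (nat \<Rightarrow> 'a set) \<Rightarrow> bool" where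
  "ultrahomogeneous \<Omega> D n P \<longleftrightarrow>
    (\<forall>A B f. A \<subseteq> \<Omega> \<and> B \<subseteq> \<Omega> \<and> finite A \<and> finite B \<and> colored_D_iso D n P A B f \<longrightarrow>
      (\<exists>g. colored_D_iso D n P \<Omega> \<Omega> g \<and> (\<forall>x\<in>A. g x = f x)))"

end

theory Submission
  imports Defs
begin

text \<open>Three distinct points \<open>a, b, c\<close> determine a branching point, and "lying in the same direction
  from it" is a relation definable from \<open>D, a, b, c\<close> whose classes form a node splitting; every node
  splitting arises in this way.

  If \<open>\<Omega>\<close> is dense and regular and the infinite sectors meet all colors, a finite partial isomorphism
  on \<open>A\<close> extends to any further point \<open>c\<close>: the type of \<open>c\<close> over \<open>A\<close> is given by the partition of \<open>A\<close>
  into directions as seen from the point where \<open>c\<close> branches off the tree spanned by \<open>A\<close>. If there are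
  at least three directions, this point is a branching point of that tree and regularity provides a
  free direction on the other side; if there are two, it is interior to an edge and density provides
  a branching point there. In both cases the new direction is an infinite sector, so the color of
  \<open>c\<close> occurs in it. Back and forth then gives an automorphism.

  Conversely, in an ultrahomogeneous \<open>\<Omega>\<close> any two triples of distinct points with equal colors are
  conjugate. This forces infinite sectors to meet all colors; then any two node splittings contain
  equally colored triples and hence are conjugate. For density, a configuration \<open>wx|yz\<close> with a point
  branching off between its two halves is found with prescribed colors inside a cone, and is then
  moved onto the given one.\<close>

section \<open>Cones and nodes\<close>

context D_set
begin

section \<open>Symmetries, exclusion and transitivity of \<open>D\<close>\<close>

lemma D_swap_left: "\<lbrakk>w \<in> \<Omega>; x \<in> \<Omega>; y \<in> \<Omega>; z \<in> \<Omega>\<rbrakk> \<Longrightarrow> D w x y z \<longleftrightarrow> D x w y z"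
  and D_swap_pairs: "\<lbrakk>w \<in> \<Omega>; x \<in> \<Omega>; y \<in> \<Omega>; z \<in> \<Omega>\<rbrakk> \<Longrightarrow> D w x y z \<longleftrightarrow> D y z w x"
  using D1 by blast+

lemma D_swap_right: "\<lbrakk>w \<in> \<Omega>; x \<in> \<Omega>; y \<in> \<Omega>; z \<in> \<Omega>\<rbrakk> \<Longrightarrow> D w x y z \<longleftrightarrow> D w x z y"
  using D_swap_left[of y z w x] D_swap_pairs[of w x y z] D_swap_pairs[of z y w x] by simp

lemmas D_comm = D_swap_left D_swap_pairs D_swap_right

lemma D_exclusive:
  assumes "w \<in> \<Omega>" "x \<in> \<Omega>" "y \<in> \<Omega>" "z \<in> \<Omega>" "D w x y z"
  shows "\<not> D w y x z" "\<not> D w z x y"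
  using assms D2[of w x y z] D2[of w x z y] by (auto simp: D_comm)

text \<open>Were \<open>w = y\<close>, D2 would forbid \<open>D w w x z\<close>; yet this follows
  from D4 if \<open>x\<close> and \<open>z\<close> differ from \<open>w\<close>, and is a
  rearrangement of \<open>D w x y z\<close> itself otherwise.\<close>

lemma D_disjoint:
  assumes "w \<in> \<Omega>" "x \<in> \<Omega>" "y \<in> \<Omega>" "z \<in> \<Omega>" "D w x y z"
  shows "{w, x} \<inter> {y, z} = {}"
proof -
  have *: "w' \<noteq> y'" if "w' \<in> \<Omega>" "x' \<in> \<Omega>" "y' \<in> \<Omega>" "z' \<in> \<Omega>" "D w' x' y' z'" for w' x' y' z'
  proof
    assume eq: "w' = y'"
    have "\<not> D w' w' x' z'" using D2[OF that] eq by simp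
    moreover have "D w' w' x' z'" if "x' \<noteq> w'" "z' \<noteq> w'"
      using D4[of x' z' w'] that D_swap_pairs \<open>w' \<in> \<Omega>\<close> \<open>x' \<in> \<Omega>\<close> \<open>z' \<in> \<Omega>\<close> by blast
    moreover have "D w' w' x' z'" if "x' = w'" using \<open>D w' x' y' z'\<close> eq that by simp
    moreover have "D w' w' x' z'" if "z' = w'"
      using \<open>D w' x' y' z'\<close> eq that D_exclusive(2)[of w' x' y' z'] \<open>w' \<in> \<Omega>\<close> \<open>x' \<in> \<Omega>\<close> \<open>z' \<in> \<Omega>\<close>
      by (simp add: D_comm)
    ultimately show False by blast
  qed
  show ?thesis
    using *[of w x y z] *[of x w y z] *[of w x z y] *[of x w z y] assms by (auto simp: D_comm)
qed

lemma D_degenerate: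
  "\<lbrakk>w \<in> \<Omega>; x \<in> \<Omega>; y \<in> \<Omega>; w \<noteq> y; x \<noteq> y\<rbrakk> \<Longrightarrow> D y y w x"
  using D4 D_swap_pairs by blast

lemma D_insert_left:
  assumes "w \<in> \<Omega>" "x \<in> \<Omega>" "y \<in> \<Omega>" "z \<in> \<Omega>" "v \<in> \<Omega>" "D w x y z" "\<not> D w x y v"
  shows "D v x y z" "D w v y z"
  using assms D3[of w x y z] D3[of x w y z] by (auto simp: D_swap_left)

text \<open>If \<open>v\<close> were not grouped with \<open>y\<close>, D3 would insert
  \<open>v\<close> into the first relation and \<open>y\<close> into the second, pairing the points
  \<open>x\<close>, \<open>y\<close>, \<open>z\<close>, \<open>v\<close> in two incompatible
  ways.\<close>

lemma D_trans:
  assumes "w \<in> \<Omega>" "x \<in> \<Omega>" "y \<in> \<Omega>" "z \<in> \<Omega>" "v \<in> \<Omega>" "D w x y z" "D w x z v"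
  shows "D w x y v"
proof (rule ccontr)
  assume neg: "\<not> D w x y v"
  have "D v x y z" using D_insert_left assms neg by blast
  moreover have "D y x v z"
    using D_insert_left[of w x v z y] assms neg by (simp add: D_comm)
  ultimately show False
    using D_exclusive[of x v y z] assms by (simp add: D_comm)
qed

lemma D_eq_iff: "\<lbrakk>x \<in> \<Omega>; y \<in> \<Omega>\<rbrakk> \<Longrightarrow> D x x y y \<longleftrightarrow> x \<noteq> y"
  using D4[of x x y] D_disjoint[of x x y y] by blast

text \<open>For distinct points, the part of \<open>\<Omega>\<close> lying in the direction of
  \<open>c\<close> from the branching point of \<open>a\<close>, \<open>b\<close>,
  \<open>c\<close>.\<close>

definition cone :: "'a \<Rightarrow> 'a \<Rightarrow> 'a \<Rightarrow> 'a set" where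
  "cone a b c = {v \<in> \<Omega>. D a b c v}"

lemma cone_self: "\<lbrakk>a \<in> \<Omega>; b \<in> \<Omega>; c \<in> \<Omega>; a \<noteq> c; b \<noteq> c\<rbrakk> \<Longrightarrow> c \<in> cone a b c"
  using D4 by (simp add: cone_def)

lemma cone_subset:
  assumes "a \<in> \<Omega>" "b \<in> \<Omega>" "c \<in> \<Omega>" "e \<in> cone a b c"
  shows "cone a e c \<subseteq> cone a b c"
proof
  fix v assume "v \<in> cone a e c"
  then have v: "v \<in> \<Omega>" "D a e c v" by (auto simp: cone_def)
  have e: "e \<in> \<Omega>" "D a b c e" using assms by (auto simp: cone_def)
  have "D a b c v"
  proof (rule ccontr)
    assume "\<not> D a b c v"
    then have "D a v c e" using D_insert_left assms e v by blast
    then show False using D_exclusive[of a e c v] v e assms by (simp add: D_comm)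
  qed
  then show "v \<in> cone a b c" using v by (simp add: cone_def)
qed

lemma cone_psubset:
  assumes "a \<in> \<Omega>" "b \<in> \<Omega>" "c \<in> \<Omega>" "e \<in> cone a b c"
  shows "cone a e c \<subset> cone a b c"
proof -
  have "e \<notin> cone a e c" using D_disjoint[of a e c e] assms by (auto simp: cone_def)
  then show ?thesis using cone_subset assms by blast
qed

lemma cone_D:
  assumes "a \<in> \<Omega>" "b \<in> \<Omega>" "c \<in> \<Omega>" "u \<in> cone a b c" "v \<in> cone a b c"
  shows "D a b u v"
  using assms D_trans[of a b u c v] by (auto simp: cone_def D_comm)

lemma cone_change_base:
  assumes "a \<in> \<Omega>" "b \<in> \<Omega>" "c \<in> \<Omega>" "e \<in> cone a b c"
  shows "cone a b e = cone a b c"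
proof -
  have e: "e \<in> \<Omega>" "D a b c e" using assms by (simp_all add: cone_def)
  then have "D a b e c" using D_swap_right[of a b c e] assms by simp
  then have "D a b e v \<longleftrightarrow> D a b c v" if "v \<in> \<Omega>" for v
    using D_trans[of a b c e v] D_trans[of a b e c v] e assms(1-3) that by blast
  then show ?thesis by (auto simp: cone_def)
qed

lemma subcone:
  assumes "a \<in> \<Omega>" "b \<in> \<Omega>" "c \<in> \<Omega>" "u \<in> cone a b c" "v \<in> cone a b c"
  shows "cone a u v \<subseteq> cone a b c" "u \<notin> cone a u v"
proof -
  have uv: "u \<in> \<Omega>" "v \<in> \<Omega>" using assms by (auto simp: cone_def)
  show "cone a u v \<subseteq> cone a b c"
    using cone_subset[of a b v u] cone_change_base[of a b c v] assms uv by simp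
  show "u \<notin> cone a u v" using D_disjoint[of a u v u] assms uv by (auto simp: cone_def)
qed

lemma cone_sub_sector:
  assumes S: "splitting \<Omega> D \<S>" "S \<in> \<S>" and ab: "a \<in> S" "b \<in> S" and p: "p \<in> \<Omega> - S"
  shows "cone p a b \<subseteq> S"
proof
  fix v assume v: "v \<in> cone p a b"
  have "S \<subseteq> \<Omega>" using S partition_onD1[of \<Omega> \<S>] by (auto simp: splitting_def)
  then have i: "a \<in> \<Omega>" "b \<in> \<Omega>" "p \<in> \<Omega>" "v \<in> \<Omega>" "D p a b v" using ab p v by (auto simp: cone_def)
  show "v \<in> S"
  proof (rule ccontr)
    assume "v \<notin> S"
    then have "D a b p v" using S ab p i unfolding splitting_def by blast
    then show False using D_exclusive[of a p b v] i by (simp add: D_comm)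
  qed
qed

text \<open>If \<open>u\<close> and \<open>v\<close> lie in one direction, at most one of
  \<open>a\<close>, \<open>b\<close>, \<open>c\<close> lies there too, so a pair of base points
  outside it witnesses this; hence the disjunction over pairs.\<close>

definition node_eq :: "'a \<Rightarrow> 'a \<Rightarrow> 'a \<Rightarrow> 'a \<Rightarrow> 'a \<Rightarrow> bool" where
  "node_eq a b c u v \<longleftrightarrow> D a b u v \<or> D a c u v \<or> D b c u v"

definition node_class :: "'a \<Rightarrow> 'a \<Rightarrow> 'a \<Rightarrow> 'a \<Rightarrow> 'a set" where
  "node_class a b c u = {v \<in> \<Omega>. node_eq a b c u v}"

lemma node_eq_sym:
  "\<lbrakk>a \<in> \<Omega>; b \<in> \<Omega>; c \<in> \<Omega>; u \<in> \<Omega>; v \<in> \<Omega>\<rbrakk> \<Longrightarrow> node_eq a b c u v = node_eq a b c v u"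
  by (simp add: node_eq_def D_comm)

end

text \<open>A triple of distinct points \<open>a, b, c\<close> stands for the branching point where the paths between
  them meet; two points are \<open>node_eq\<close> if they lie in the same direction as seen from there.\<close>

locale D_node = D_set +
  fixes a b c :: 'a
  assumes a_in: "a \<in> \<Omega>" and b_in: "b \<in> \<Omega>" and c_in: "c \<in> \<Omega>"
    and a_neq_b: "a \<noteq> b" and a_neq_c: "a \<noteq> c" and b_neq_c: "b \<noteq> c"
begin

lemmas abc_in = a_in b_in c_in

abbreviation eqv (infix "\<sim>" 50) where "u \<sim> v \<equiv> node_eq a b c u v"

lemma eqv_refl: "u \<in> \<Omega> \<Longrightarrow> u \<sim> u"
  unfolding node_eq_def
  using D4[of a b u] D4[of a c u] D4[of b c u] abc_in a_neq_b a_neq_c b_neq_c by auto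

lemma eqv_sym: "\<lbrakk>u \<in> \<Omega>; v \<in> \<Omega>; u \<sim> v\<rbrakk> \<Longrightarrow> v \<sim> u"
  using node_eq_sym abc_in by blast

text \<open>Two of the three disjuncts put the base point on both sides of \<open>D\<close>, so the
  direction of a base point is a cone.\<close>

lemma eqv_base:
  "u \<in> \<Omega> \<Longrightarrow> a \<sim> u \<longleftrightarrow> D b c a u" "u \<in> \<Omega> \<Longrightarrow> b \<sim> u \<longleftrightarrow> D a c b u"
  "u \<in> \<Omega> \<Longrightarrow> c \<sim> u \<longleftrightarrow> D a b c u"
  unfolding node_eq_def
  using abc_in D_disjoint[of a b a u] D_disjoint[of a c a u] D_disjoint[of a b b u]
    D_disjoint[of b c b u] D_disjoint[of a c c u] D_disjoint[of b c c u] by auto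

lemma base_not_eqv: "\<not> a \<sim> b" "\<not> a \<sim> c" "\<not> b \<sim> c"
  using eqv_base abc_in D_disjoint[of b c a b] D_disjoint[of b c a c] D_disjoint[of a c b c] by auto

text \<open>The pair \<open>p\<close>, \<open>q\<close> witnessing \<open>u \<sim> v\<close> groups
  neither \<open>w\<close> nor \<open>t\<close> with \<open>u\<close>, so D3 allows \<open>w\<close>
  and \<open>t\<close> to replace \<open>q\<close>; transitivity then removes
  \<open>p\<close>.\<close>

lemma eqv_D:
  assumes "u \<in> \<Omega>" "v \<in> \<Omega>" "w \<in> \<Omega>" "t \<in> \<Omega>" "u \<sim> v" "\<not> u \<sim> w" "\<not> u \<sim> t"
  shows "D u v w t"
proof -
  obtain p q where pq: "p \<in> \<Omega>" "q \<in> \<Omega>" "D p q u v" "\<not> D p q u w" "\<not> D p q u t"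
    using assms(5-7) abc_in unfolding node_eq_def by blast
  have "D p w u v" "D p t u v" using D_insert_left pq assms by blast+
  then have "D u v w p" "D u v p t" using pq assms by (simp_all add: D_comm)
  then show ?thesis using D_trans pq assms by blast
qed

text \<open>Failure would make the base pairs witnessing \<open>u \<sim> v\<close> and
  \<open>v \<sim> w\<close> disjoint, but two pairs chosen from \<open>{a, b, c}\<close> share a
  point.\<close>

lemma eqv_trans:
  assumes "u \<in> \<Omega>" "v \<in> \<Omega>" "w \<in> \<Omega>" "u \<sim> v" "v \<sim> w"
  shows "u \<sim> w"
proof (rule ccontr)
  assume neg: "\<not> u \<sim> w"
  obtain p q where pq: "p \<in> {a,b,c}" "q \<in> {a,b,c}" "p \<noteq> q" "D p q u v" "\<not> D p q u w"
    using assms(4) neg a_neq_b a_neq_c b_neq_c unfolding node_eq_def by blast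
  obtain r s where rs: "r \<in> {a,b,c}" "s \<in> {a,b,c}" "r \<noteq> s" "D r s v w" "\<not> D r s u w"
    using assms(5) neg a_neq_b a_neq_c b_neq_c unfolding node_eq_def by blast
  have in\<Omega>: "p \<in> \<Omega>" "q \<in> \<Omega>" "r \<in> \<Omega>" "s \<in> \<Omega>" using pq rs abc_in by auto
  have 1: "D p w u v" "D q w u v"
    using D_insert_left[of p q u v w] pq in\<Omega> assms by (simp_all add: D_comm)
  have 2: "D r u w v" "D s u w v"
    using D_insert_left[of r s w v u] rs in\<Omega> assms by (simp_all add: D_comm)
  have "p \<notin> {r, s}" "q \<notin> {r, s}"
    using 1 2 D_exclusive[of p w u v] D_exclusive[of q w u v] in\<Omega> assms by auto
  then show False using pq rs by auto
qed

text \<open>By the pigeonhole principle two of \<open>a\<close>, \<open>b\<close>, \<open>c\<close>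
  agree on whether \<open>D u v w p\<close> holds for them as \<open>p\<close>. If it holds, they
  lie on the side of \<open>w\<close>, \<open>t\<close> and witness \<open>u \<sim> v\<close>; if
  not, they witness \<open>w \<sim> t\<close>.\<close>

lemma D_imp_eqv:
  assumes "u \<in> \<Omega>" "v \<in> \<Omega>" "w \<in> \<Omega>" "t \<in> \<Omega>" "D u v w t"
  shows "u \<sim> v \<or> w \<sim> t"
proof -
  have right: "D p q u v" if "p \<in> \<Omega>" "q \<in> \<Omega>" "D u v w p" "D u v w q" for p q
    using that assms D_trans[of u v p w q] by (simp add: D_comm)
  have left: "D p q w t" if "p \<in> \<Omega>" "q \<in> \<Omega>" "\<not> D u v w p" "\<not> D u v w q" for p q
  proof -
    have "D p v w t" "D q v w t" using that assms D_insert_left by blast+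
    then show ?thesis
      using that assms D_trans[of w t p v q] by (simp add: D_comm)
  qed
  show ?thesis
    unfolding node_eq_def
    using right[of a b] right[of a c] right[of b c] left[of a b] left[of a c] left[of b c]
      assms abc_in by (auto simp: D_comm)
qed


lemma class_eq_iff:
  assumes "u \<in> \<Omega>" "v \<in> \<Omega>"
  shows "node_class a b c u = node_class a b c v \<longleftrightarrow> u \<sim> v"
proof
  assume eq: "node_class a b c u = node_class a b c v"
  have "v \<in> node_class a b c u" unfolding eq using eqv_refl assms by (simp add: node_class_def)
  then show "u \<sim> v" by (simp add: node_class_def)
next
  assume uv: "u \<sim> v"
  have "u \<sim> x \<longleftrightarrow> v \<sim> x" if "x \<in> \<Omega>" for x
    using eqv_trans[of u v x] eqv_trans[of v u x] eqv_sym[of u v] uv assms that by blast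
  then show "node_class a b c u = node_class a b c v" by (auto simp: node_class_def)
qed

lemma class_self: "u \<in> \<Omega> \<Longrightarrow> u \<in> node_class a b c u"
  using eqv_refl by (simp add: node_class_def)

lemma node_splitting_classes: "node_splitting \<Omega> D (node_class a b c ` \<Omega>)"
proof -
  let ?S = "node_class a b c ` \<Omega>"
  have part: "partition_on \<Omega> ?S"
    unfolding partition_on_def disjoint_def disjnt_def[symmetric]
  proof (intro conjI ballI impI)
    show "\<Union> ?S = \<Omega>" using class_self by (auto simp: node_class_def)
    show "{} \<notin> ?S" using class_self by auto
    show "disjnt p q" if pq: "p \<in> ?S" "q \<in> ?S" "p \<noteq> q" for p q
    proof -
      obtain u v where uv: "u \<in> \<Omega>" "v \<in> \<Omega>" "p = node_class a b c u" "q = node_class a b c v"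
        using pq by auto
      have False if "x \<in> \<Omega>" "u \<sim> x" "v \<sim> x" for x
        using eqv_trans[of u x v] eqv_sym[of v x] class_eq_iff[of u v] that uv \<open>p \<noteq> q\<close> by simp
      then show ?thesis using uv by (auto simp: disjnt_def node_class_def)
    qed
  qed
  have three: "at_least 3 ?S"
  proof (cases "finite ?S")
    case True
    have "node_class a b c ` {a, b, c} \<subseteq> ?S" using abc_in by auto
    moreover have "card (node_class a b c ` {a, b, c}) = 3"
      using base_not_eqv class_eq_iff abc_in a_neq_b a_neq_c b_neq_c by simp
    ultimately show ?thesis using True card_mono unfolding at_least_def by metis
  qed (simp add: at_least_def)
  have 1: "D x y z t" if S: "S \<in> ?S" "x \<in> S" "y \<in> S" "z \<in> \<Omega> - S" "t \<in> \<Omega> - S" for S x y z t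
  proof -
    obtain u where u: "u \<in> \<Omega>" "S = node_class a b c u" using S by auto
    then have xy: "x \<in> \<Omega>" "y \<in> \<Omega>" "u \<sim> x" "u \<sim> y" using that by (auto simp: node_class_def)
    have "S = node_class a b c x" using class_eq_iff u xy by simp
    then show ?thesis using eqv_D[of x y z t] that xy by (simp add: node_class_def)
  qed
  have 2: "\<not> D x y z t"
    if "A \<in> ?S" "B \<in> ?S" "C \<in> ?S" "E \<in> ?S" "distinct [A, B, C, E]" "x \<in> A" "y \<in> B" "z \<in> C" "t \<in> E"
    for A B C E x y z t
  proof
    assume "D x y z t"
    have *: "S = node_class a b c u" "u \<in> \<Omega>" if "S \<in> ?S" "u \<in> S" for S u
      using that class_eq_iff by (auto simp: node_class_def)
    have "A = node_class a b c x" "B = node_class a b c y" "C = node_class a b c z"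
      "E = node_class a b c t" "x \<in> \<Omega>" "y \<in> \<Omega>" "z \<in> \<Omega>" "t \<in> \<Omega>"
      using * that by blast+
    then show False
      using D_imp_eqv[OF _ _ _ _ \<open>D x y z t\<close>] class_eq_iff[of x y] class_eq_iff[of z t] that(5) by simp
  qed
  show ?thesis
    unfolding node_splitting_def splitting_def using part three 1 2 by (auto simp: at_least_def)
qed

text \<open>Any three points in different directions represent the same branching point. One
  implication is \<open>D_imp_eqv\<close>; for the other, at most one of \<open>p\<close>,
  \<open>q\<close>, \<open>r\<close> lies in the direction of \<open>u\<close>.\<close>

lemma eqv_change_base:
  assumes "p \<in> \<Omega>" "q \<in> \<Omega>" "r \<in> \<Omega>" "\<not> p \<sim> q" "\<not> p \<sim> r" "\<not> q \<sim> r" "u \<in> \<Omega>" "v \<in> \<Omega>"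
  shows "node_eq p q r u v \<longleftrightarrow> u \<sim> v"
proof
  show "u \<sim> v" if "node_eq p q r u v"
    using that D_imp_eqv assms unfolding node_eq_def[of p q r] by blast
  assume uv: "u \<sim> v"
  have *: "D x y u v" if "x \<in> \<Omega>" "y \<in> \<Omega>" "\<not> u \<sim> x" "\<not> u \<sim> y" for x y
    using eqv_D[of u v x y] uv that assms by (simp add: D_comm)
  have **: "\<not> u \<sim> x \<or> \<not> u \<sim> y" if "x \<in> \<Omega>" "y \<in> \<Omega>" "\<not> x \<sim> y" for x y
    using eqv_trans[of x u y] eqv_sym[of u x] that assms by blast
  show "node_eq p q r u v"
    unfolding node_eq_def using *[of p q] *[of p r] *[of q r] **[of p q] **[of p r] **[of q r] assms by blast
qed

text \<open>The right-hand side does not mention \<open>d\<close>, so the type of a point in a new direction over a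
  set is determined by the directions of the points of that set.\<close>

lemma D_new_direction_iff:
  assumes "d \<in> \<Omega>" "x \<in> \<Omega>" "y \<in> \<Omega>" "z \<in> \<Omega>" "e \<in> \<Omega>"
    and "\<not> d \<sim> x" "\<not> d \<sim> y" "\<not> d \<sim> z" "\<not> e \<sim> x"
  shows "D d x y z \<longleftrightarrow> y \<sim> z \<and> (x \<sim> y \<longrightarrow> D e x y z)"
proof -
  have 1: "y \<sim> z" if "D d x y z" using D_imp_eqv[OF _ _ _ _ that] assms by blast
  have 2: "D d x y z" if "y \<sim> z" "\<not> x \<sim> y"
  proof -
    have "D y z d x" using eqv_D[of y z d x] that assms eqv_sym by blast
    then show ?thesis using assms by (simp add: D_comm)
  qed
  have 3: "D d x y z \<longleftrightarrow> D e x y z" if "y \<sim> z" "x \<sim> y"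
  proof -
    have "\<not> x \<sim> d" "\<not> x \<sim> e" using eqv_sym assms by blast+
    \<comment> \<open>\<open>d\<close> and \<open>e\<close> both lie outside the common direction of
      \<open>x\<close>, \<open>y\<close>, \<open>z\<close>, so D3 lets either replace the other in
      \<open>D d x y z\<close>.\<close>
    then have xy: "D x y d e" using eqv_D[of x y d e] assms that by blast
    have D: "D v x y z" if "D u x y z" "D x y u v" "u \<in> \<Omega>" "v \<in> \<Omega>" for u v
      using D3[OF _ _ _ _ that(1)] D_exclusive[of x y u v] that assms by (auto simp: D_comm)
    have "D x y e d" using xy assms by (simp add: D_comm)
    then show ?thesis using D[of d e] D[of e d] xy assms by blast
  qed
  show ?thesis using 1 2 3 by blast
qed

end

context D_set
begin

lemma D_node_intro: "\<lbrakk>a \<in> \<Omega>; b \<in> \<Omega>; c \<in> \<Omega>; a \<noteq> b; a \<noteq> c; b \<noteq> c\<rbrakk> \<Longrightarrow> D_node \<Omega> D a b c"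
  by unfold_locales

text \<open>Inside a finite set \<open>X\<close>, the branching points of the paths from \<open>x\<close> to the rest of \<open>X\<close> with
  the path from \<open>x\<close> to \<open>b\<close> are linearly ordered; \<open>y\<close> realises the one closest to \<open>b\<close>.\<close>

lemma ex_extremal_pair:
  assumes "finite X" "X \<subseteq> \<Omega>" "x \<in> \<Omega>" "b \<in> \<Omega>" "x \<noteq> b"
  shows "\<exists>y\<in>insert x X. \<forall>v\<in>\<Omega>. D x y v b \<longrightarrow> (\<forall>x'\<in>X. D x x' v b)"
  using assms
proof (induction X rule: finite_induct)
  case empty
  then show ?case by auto
next
  case (insert u X)
  then obtain y where y: "y \<in> insert x X" "\<forall>v\<in>\<Omega>. D x y v b \<longrightarrow> (\<forall>x'\<in>X. D x x' v b)" by auto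
  have in\<Omega>: "u \<in> \<Omega>" "y \<in> \<Omega>" "x \<in> \<Omega>" "b \<in> \<Omega>" using insert.prems y by auto
  show ?case
  proof (cases "D x y u b")
    \<comment> \<open>\<open>u\<close> branches off closer to \<open>b\<close> than \<open>y\<close>
      and takes its place; in the other case \<open>y\<close> stays extremal.\<close>
    case True
    have "D x y v b" if v: "v \<in> \<Omega>" "D x u v b" for v
    proof (rule ccontr)
      assume neg: "\<not> D x y v b"
      have "D v y b u" using D_insert_left[of x y b u v] True neg v in\<Omega> by (simp add: D_comm)
      moreover have "D y u b v \<or> D x u b y"
        using D3[of x u b v] v in\<Omega> D_swap_right[of x u v b] by simp
      ultimately show False
        using D_exclusive[of y u b v] D_exclusive[of x u b y] True v(1) in\<Omega> by (auto simp: D_comm)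
    qed
    then have "\<forall>v\<in>\<Omega>. D x u v b \<longrightarrow> (\<forall>x'\<in>insert u X. D x x' v b)" using y(2) by blast
    then show ?thesis by blast
  next
    case False
    have "D x u v b" if v: "v \<in> \<Omega>" "D x y v b" for v
      using D_insert_left[of x y b v u] False v in\<Omega> by (simp add: D_comm)
    then have "\<forall>v\<in>\<Omega>. D x y v b \<longrightarrow> (\<forall>x'\<in>insert u X. D x x' v b)" using y(2) by blast
    then show ?thesis using y(1) by blast
  qed
qed

end

section \<open>Infinite cones and sectors\<close>

context proper_D_set
begin

text \<open>D5 supplies \<open>z \<noteq> c\<close> in the cone, and \<open>cone a z c\<close> is a
  proper subcone of the same kind, so a finite cone would allow infinite descent.\<close>

lemma cone_infinite:
  assumes "a \<in> \<Omega>" "b \<in> \<Omega>" "c \<in> \<Omega>" "a \<noteq> b" "a \<noteq> c" "b \<noteq> c"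
  shows "infinite (cone a b c)"
proof
  assume "finite (cone a b c)"
  then show False using assms(2,4,6)
  proof (induction "card (cone a b c)" arbitrary: b rule: less_induct)
    case less
    obtain z where z: "z \<in> \<Omega>" "z \<noteq> c" "D a b c z" using D5[of a b c] less assms by blast
    then have "z \<in> cone a b c" by (simp add: cone_def)
    then have sub: "cone a z c \<subset> cone a b c" using cone_psubset less.prems assms by blast
    have "a \<noteq> z" using D_disjoint[of a b c z] z less.prems assms by blast
    moreover have "card (cone a z c) < card (cone a b c)" using sub less.prems psubset_card_mono by blast
    moreover have "finite (cone a z c)" using sub less.prems finite_subset by blast
    ultimately show False using less.hyps z by blast
  qed
qed

text \<open>At least two of \<open>a\<close>, \<open>b\<close>, \<open>c\<close> differ from
  \<open>u\<close>, and the cone of \<open>u\<close> over such a pair lies in the class.\<close>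

lemma node_class_infinite:
  assumes "D_node \<Omega> D a b c" "u \<in> \<Omega>"
  shows "infinite (node_class a b c u)"
proof -
  interpret N: D_node \<Omega> D a b c by fact
  note N.abc_in N.a_neq_b N.a_neq_c N.b_neq_c
  then obtain x y where "x \<in> \<Omega>" "y \<in> \<Omega>" "x \<noteq> y" "x \<noteq> u" "y \<noteq> u"
    "cone x y u \<subseteq> node_class a b c u"
    unfolding cone_def node_class_def node_eq_def by blast
  then show ?thesis using cone_infinite[of x y u] assms(2) finite_subset by blast
qed

lemma obtain_distinct_triple:
  assumes "x \<in> \<Omega>"
  obtains y z where "y \<in> \<Omega>" "z \<in> \<Omega>" "y \<noteq> x" "z \<noteq> x" "y \<noteq> z"
proof -
  have "infinite (\<Omega> - {x}) \<or> card (\<Omega> - {x}) \<ge> 2"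
    using three_points assms card_Suc_Diff1[of \<Omega> x] unfolding at_least_def by auto
  then have "\<exists>T\<subseteq>\<Omega> - {x}. card T = 2" using infinite_arbitrarily_large obtain_subset_with_card_n by metis
  then show thesis using that unfolding card_2_iff by blast
qed

end

section \<open>Extending finite partial isomorphisms\<close>

text \<open>\<open>R\<close> is the union of an increasing chain of stages satisfying
  \<open>Q\<close>. Any statement on finitely many pairs of \<open>R\<close> can be read off a
  single stage; \<open>Q\<close> itself need not pass to \<open>R\<close>.\<close>

lemma back_and_forth:
  assumes X: "countable X" "X \<noteq> {}" and Y: "countable Y" "Y \<noteq> {}" and Q: "Q F0"
    and fwd: "\<And>F x. \<lbrakk>Q F; x \<in> X\<rbrakk> \<Longrightarrow> \<exists>y\<in>Y. Q (insert (x, y) F)"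
    and bwd: "\<And>F y. \<lbrakk>Q F; y \<in> Y\<rbrakk> \<Longrightarrow> \<exists>x\<in>X. Q (insert (x, y) F)"
  obtains R where "F0 \<subseteq> R" "X \<subseteq> Domain R" "Y \<subseteq> Range R"
    "\<And>G. \<lbrakk>finite G; G \<subseteq> R\<rbrakk> \<Longrightarrow> \<exists>F. G \<subseteq> F \<and> Q F"
proof -
  have step: "\<exists>F'. Q F' \<and> F \<subseteq> F' \<and> from_nat_into X k \<in> Domain F' \<and> from_nat_into Y k \<in> Range F'"
    if F: "Q F" for F k
  proof -
    obtain y where y: "Q (insert (from_nat_into X k, y) F)"
      using fwd F from_nat_into X by metis
    obtain x where "Q (insert (x, from_nat_into Y k) (insert (from_nat_into X k, y) F))"
      using bwd y from_nat_into Y by metis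
    then show ?thesis
      by (intro exI[of _ "insert (x, from_nat_into Y k) (insert (from_nat_into X k, y) F)"]) auto
  qed
  \<comment> \<open>Stage \<open>Suc k\<close> takes in the \<open>k\<close>-th points of both
    enumerations, so all points are eventually reached.\<close>
  have "\<exists>f. \<forall>k. (Q (f k) \<and> (k = 0 \<longrightarrow> f k = F0)) \<and>
      (f k \<subseteq> f (Suc k) \<and> from_nat_into X k \<in> Domain (f (Suc k)) \<and> from_nat_into Y k \<in> Range (f (Suc k)))"
    by (rule dependent_nat_choice) (use Q step in auto)
  then obtain f where f: "\<And>k. Q (f k)" "f 0 = F0" "\<And>k. f k \<subseteq> f (Suc k)"
      "\<And>k. from_nat_into X k \<in> Domain (f (Suc k))" "\<And>k. from_nat_into Y k \<in> Range (f (Suc k))"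
    by blast
  define R where "R = (\<Union>k. f k)"
  have mono: "f k \<subseteq> f l" if "k \<le> l" for k l using lift_Suc_mono_le[of f] f(3) that by blast
  show thesis
  proof
    show "F0 \<subseteq> R" using f(2) by (auto simp: R_def)
    show "X \<subseteq> Domain R"
    proof
      fix x assume "x \<in> X"
      then obtain k where "x = from_nat_into X k" using from_nat_into_surj[OF X(1)] by metis
      then show "x \<in> Domain R" using f(4)[of k] by (auto simp: R_def)
    qed
    show "Y \<subseteq> Range R"
    proof
      fix y assume "y \<in> Y"
      then obtain k where "y = from_nat_into Y k" using from_nat_into_surj[OF Y(1)] by metis
      then show "y \<in> Range R" using f(5)[of k] by (auto simp: R_def)
    qed
    show "\<exists>F. G \<subseteq> F \<and> Q F" if "finite G" "G \<subseteq> R" for G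
    proof -
      have "\<exists>k. G \<subseteq> f k" using that
      proof (induction G rule: finite_induct)
        case (insert p G)
        then obtain k l where "G \<subseteq> f k" "p \<in> f l" by (auto simp: R_def)
        then have "insert p G \<subseteq> f (max k l)" using mono[of k "max k l"] mono[of l "max k l"] by auto
        then show ?case by blast
      qed auto
      then show ?thesis using f(1) by blast
    qed
  qed
qed

text \<open>While the cone contains a point \<open>e\<close> of \<open>A\<close>, taking
  \<open>e\<close> for \<open>b\<close> shrinks it. For \<open>c\<close> outside \<open>A\<close>
  the result locates the point where \<open>c\<close> branches off the tree spanned by
  \<open>A\<close>.\<close>

lemma (in D_set) ex_cone_avoiding:
  assumes "finite A" "A \<subseteq> \<Omega>" "a \<in> A" "b \<in> A" "a \<noteq> b" "c \<in> \<Omega>"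
  shows "\<exists>b\<in>A. a \<noteq> b \<and> cone a b c \<inter> A = {}"
  using assms(4,5)
proof (induction "card (cone a b c \<inter> A)" arbitrary: b rule: less_induct)
  case less
  show ?case
  proof (cases "cone a b c \<inter> A = {}")
    case False
    then obtain e where e: "e \<in> cone a b c" "e \<in> A" by blast
    have in\<Omega>: "a \<in> \<Omega>" "b \<in> \<Omega>" "e \<in> \<Omega>" using less.prems assms e by auto
    have "D a b c e" using e by (simp add: cone_def)
    then have "a \<noteq> e" using D_disjoint[of a b c e] in\<Omega> assms by blast
    have "e \<notin> cone a e c" using D_disjoint[of a e c e] in\<Omega> assms by (auto simp: cone_def)
    then have "cone a e c \<inter> A \<subset> cone a b c \<inter> A" using cone_subset[of a b c e] in\<Omega> assms e by blast
    then have "card (cone a e c \<inter> A) < card (cone a b c \<inter> A)"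
      using assms(1) by (simp add: psubset_card_mono)
    then show ?thesis using less.hyps e(2) \<open>a \<noteq> e\<close> by blast
  qed (use less.prems in blast)
qed

text \<open>\<open>X\<close> and \<open>Y\<close> are the two sides of an edge of the tree spanned by \<open>X \<union> Y\<close>.\<close>

lemma (in D_set) dense_edge_point:
  assumes "dense_D \<Omega> D" "finite X" "X \<subseteq> \<Omega>" "finite Y" "Y \<subseteq> \<Omega>" "a \<in> X" "b \<in> Y"
    and XY: "\<And>x y. \<lbrakk>x \<in> X; y \<in> Y\<rbrakk> \<Longrightarrow> D a x b y"
  obtains v where "v \<in> \<Omega>" "\<And>x. x \<in> X \<Longrightarrow> D a x v b" "\<And>y. y \<in> Y \<Longrightarrow> D b y v a"
proof -
  have in\<Omega>: "a \<in> \<Omega>" "b \<in> \<Omega>" using assms by auto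
  have "a \<noteq> b" using XY[of a b] D_disjoint[of a a b b] in\<Omega> assms by auto
  \<comment> \<open>\<open>x\<close> and \<open>y\<close> branch off closest to the edge on either
    side, so one application of density to them serves all of \<open>X\<close> and
    \<open>Y\<close>.\<close>
  obtain x where x: "x \<in> X" "\<And>v x'. \<lbrakk>v \<in> \<Omega>; D a x v b; x' \<in> X\<rbrakk> \<Longrightarrow> D a x' v b"
    using ex_extremal_pair[of X a b] \<open>a \<noteq> b\<close> in\<Omega> assms by (auto simp: insert_absorb)
  obtain y where y: "y \<in> Y" "\<And>v y'. \<lbrakk>v \<in> \<Omega>; D b y v a; y' \<in> Y\<rbrakk> \<Longrightarrow> D b y' v a"
    using ex_extremal_pair[of Y b a] \<open>a \<noteq> b\<close> in\<Omega> assms by (auto simp: insert_absorb)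
  have xy: "x \<in> \<Omega>" "y \<in> \<Omega>" using x y assms by auto
  have "\<exists>v\<in>\<Omega>. D v x b y \<and> D a v b y \<and> D a x v y \<and> D a x b v"
    using assms(1) XY[OF x(1) y(1)] in\<Omega> xy unfolding dense_D_def by blast
  then obtain v where v: "v \<in> \<Omega>" "D a v b y" "D a x b v" by blast
  have "D a x v b" "D b y v a" using v in\<Omega> xy by (simp_all add: D_comm)
  then show thesis using that v x y by blast
qed

section \<open>Finite partial isomorphisms of the colored structure\<close>

locale proper_colored_D_set = proper_D_set \<Omega> D + colored_D_set \<Omega> D n P
  for \<Omega> :: "'a set" and D n P
begin

definition same_color :: "'a \<Rightarrow> 'a \<Rightarrow> bool" where
  "same_color x y \<longleftrightarrow> (\<forall>i\<in>{1..n}. y \<in> P i \<longleftrightarrow> x \<in> P i)"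

text \<open>A relation rather than a map, so that converses are immediate. Being single-valued and
  injective comes for free, as \<open>D x x y y\<close> expresses
  \<open>x \<noteq> y\<close>.\<close>

definition part_iso :: "('a \<times> 'a) set \<Rightarrow> bool" where
  "part_iso F \<longleftrightarrow> finite F \<and> F \<subseteq> \<Omega> \<times> \<Omega> \<and> (\<forall>x x'. (x, x') \<in> F \<longrightarrow> same_color x x') \<and>
    (\<forall>w w' x x' y y' z z'. (w, w') \<in> F \<longrightarrow> (x, x') \<in> F \<longrightarrow> (y, y') \<in> F \<longrightarrow> (z, z') \<in> F \<longrightarrow>
      (D w x y z \<longleftrightarrow> D w' x' y' z'))"

lemma ex_color: "x \<in> \<Omega> \<Longrightarrow> \<exists>i\<in>{1..n}. x \<in> P i"
  using colors_cover by blast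

lemma same_colorI:
  assumes i: "i \<in> {1..n}" and xy: "x \<in> P i" "y \<in> P i"
  shows "same_color x y"
proof -
  have "z \<in> P j \<longleftrightarrow> j = i" if "j \<in> {1..n}" "z \<in> P i" for j z
    using disjoint_family_onD[OF colors_disjoint that(1) i] that(2) by blast
  then show ?thesis using xy by (simp add: same_color_def)
qed

lemma part_isoD:
  assumes "part_iso F"
  shows "\<lbrakk>(w, w') \<in> F; (x, x') \<in> F; (y, y') \<in> F; (z, z') \<in> F\<rbrakk> \<Longrightarrow> D w x y z \<longleftrightarrow> D w' x' y' z'"
    and "(x, x') \<in> F \<Longrightarrow> same_color x x'" and "(x, x') \<in> F \<Longrightarrow> x \<in> \<Omega> \<and> x' \<in> \<Omega>"
    and "finite F"
  using assms unfolding part_iso_def by simp_all blast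

lemma part_iso_eq_iff: "\<lbrakk>part_iso F; (x, x') \<in> F; (y, y') \<in> F\<rbrakk> \<Longrightarrow> x = y \<longleftrightarrow> x' = y'"
  using part_isoD(1)[of F x x' x x' y y' y y'] part_isoD(3)[of F x x'] part_isoD(3)[of F y y']
    D_eq_iff[of x y] D_eq_iff[of x' y'] by simp

lemma part_iso_converse: "part_iso F \<Longrightarrow> part_iso (F\<inverse>)"
  unfolding part_iso_def same_color_def by (simp add: converse_subset_swap) blast

text \<open>Quadruples with a repeated point are decided by equalities alone, through D4 and
  \<open>D_disjoint\<close>; by the symmetries of \<open>D\<close> only \<open>c\<close> against
  three distinct old points remains.\<close>

lemma part_iso_insert:
  assumes F: "part_iso F" and cd: "c \<in> \<Omega>" "d \<in> \<Omega>" "same_color c d" "c \<notin> Domain F" "d \<notin> Range F"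
    and ext: "\<And>x x' y y' z z'. \<lbrakk>(x, x') \<in> F; (y, y') \<in> F; (z, z') \<in> F; x \<noteq> y; x \<noteq> z; y \<noteq> z\<rbrakk>
      \<Longrightarrow> D c x y z \<longleftrightarrow> D d x' y' z'"
  shows "part_iso (insert (c, d) F)"
proof -
  let ?F = "insert (c, d) F"
  have in\<Omega>: "x \<in> \<Omega>" "x' \<in> \<Omega>" if "(x, x') \<in> ?F" for x x' using that part_isoD(3)[OF F] cd by blast+
  have *: "D c x y z \<longleftrightarrow> D d x' y' z'" if xyz: "(x, x') \<in> ?F" "(y, y') \<in> ?F" "(z, z') \<in> ?F" for x x' y y' z z'
  proof (cases "(y, y') = (c, d) \<or> (z, z') = (c, d)")
    case True
    then have "\<not> D c x y z" "\<not> D d x' y' z'"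
      using D_disjoint[of c x y z] D_disjoint[of d x' y' z'] in\<Omega>[OF xyz(1)] in\<Omega>[OF xyz(2)] in\<Omega>[OF xyz(3)] cd
      by auto
    then show ?thesis by blast
  next
    case False
    then have yz: "(y, y') \<in> F" "(z, z') \<in> F" using xyz by auto
    show ?thesis
    proof (cases "(x, x') = (c, d)")
      case True
      have "y \<noteq> c" "z \<noteq> c" "y' \<noteq> d" "z' \<noteq> d" using yz cd by auto
      then have "D c c y z" "D d d y' z'" using D_degenerate in\<Omega>[OF xyz(2)] in\<Omega>[OF xyz(3)] cd by blast+
      then show ?thesis using True by simp
    next
      case False
      then have x: "(x, x') \<in> F" using xyz by auto
      note eq = part_iso_eq_iff[OF F x yz(1)] part_iso_eq_iff[OF F x yz(2)] part_iso_eq_iff[OF F yz]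
      note i = in\<Omega>[OF xyz(1)] in\<Omega>[OF xyz(2)] in\<Omega>[OF xyz(3)] cd(1,2)
      consider "x = y \<or> x = z" | "y = z" "x \<noteq> y" | "x \<noteq> y" "x \<noteq> z" "y \<noteq> z" by blast
      then show ?thesis
      proof cases
        case 1
        then have "\<not> D c x y z" "\<not> D d x' y' z'"
          using eq D_disjoint[of c x y z] D_disjoint[of d x' y' z'] i by auto
        then show ?thesis by blast
      next
        case 2
        then have "x' \<noteq> y'" "y' = z'" "y \<noteq> c" "y' \<noteq> d" using eq yz cd by auto
        then show ?thesis using D4[of c x y] D4[of d x' y'] 2 i by auto
      next
        case 3
        then show ?thesis using ext[OF x yz] by blast
      qed
    qed
  qed
  have "D w x y z \<longleftrightarrow> D w' x' y' z'"
    if wxyz: "(w, w') \<in> ?F" "(x, x') \<in> ?F" "(y, y') \<in> ?F" "(z, z') \<in> ?F" for w w' x x' y y' z z'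
  proof -
    note i = in\<Omega>[OF wxyz(1)] in\<Omega>[OF wxyz(2)] in\<Omega>[OF wxyz(3)] in\<Omega>[OF wxyz(4)] cd(1,2)
    consider "(w, w') = (c, d)" | "(x, x') = (c, d)" | "(y, y') = (c, d)" | "(z, z') = (c, d)"
      | "(w, w') \<in> F" "(x, x') \<in> F" "(y, y') \<in> F" "(z, z') \<in> F" using wxyz by blast
    then show ?thesis
    proof cases
      case 1
      then show ?thesis using *[OF wxyz(2,3,4)] by simp
    next
      case 2
      then show ?thesis using *[OF wxyz(1,3,4)] i by (simp add: D_swap_left[of _ c] D_swap_left[of _ d])
    next
      case 3
      then show ?thesis using *[OF wxyz(4,1,2)] i
          D_swap_pairs[of w x c z] D_swap_pairs[of w' x' d z'] by simp
    next
      case 4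
      then show ?thesis using *[OF wxyz(3,1,2)] i
          D_swap_pairs[of w x c y] D_swap_pairs[of w' x' d y'] D_swap_right[of w x y c] D_swap_right[of w' x' y' d] by simp
    next
      case 5
      then show ?thesis using part_isoD(1)[OF F] by blast
    qed
  qed
  moreover have "?F \<subseteq> \<Omega> \<times> \<Omega>" using in\<Omega> by auto
  moreover have "same_color x x'" if "(x, x') \<in> ?F" for x x'
    using that cd(3) part_isoD(2)[OF F] by blast
  ultimately show ?thesis unfolding part_iso_def using part_isoD(4)[OF F] by simp
qed

end

text \<open>The case of an interior point of an edge: seen from the branching point of
  \<open>a\<close>, \<open>b\<close>, \<open>c\<close>, the set \<open>A\<close> splits into just
  two sides \<open>X\<close> and \<open>Y\<close>. The map \<open>f\<close> preserves this
  separation, and density puts a new branching point between the images.\<close>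

lemma (in D_set) ex_matching_node_edge:
  assumes dense: "dense_D \<Omega> D" and A: "finite A" "A \<subseteq> \<Omega>" "f ` A \<subseteq> \<Omega>"
    and f: "\<And>w x y z. \<lbrakk>w \<in> A; x \<in> A; y \<in> A; z \<in> A\<rbrakk> \<Longrightarrow> D (f w) (f x) (f y) (f z) \<longleftrightarrow> D w x y z"
    and N: "D_node \<Omega> D a b c" and ab: "a \<in> A" "b \<in> A"
    and two: "\<And>x. x \<in> A \<Longrightarrow> node_eq a b c a x \<or> node_eq a b c b x"
  obtains d where "D_node \<Omega> D (f a) (f b) d"
    "\<And>x y. \<lbrakk>x \<in> A; y \<in> A\<rbrakk> \<Longrightarrow> node_eq (f a) (f b) d (f x) (f y) \<longleftrightarrow> node_eq a b c x y"
    "\<And>x. x \<in> A \<Longrightarrow> \<not> node_eq (f a) (f b) d d (f x)"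
proof -
  interpret N: D_node \<Omega> D a b c by fact
  define X where "X = {x \<in> A. node_eq a b c a x}"
  define Y where "Y = {x \<in> A. node_eq a b c b x}"
  have XYA: "X \<subseteq> A" "Y \<subseteq> A" "a \<in> X" "b \<in> Y" "A = X \<union> Y"
    using ab N.eqv_refl N.abc_in two by (auto simp: X_def Y_def)
  have notXY: "\<not> node_eq a b c x y" if xy: "x \<in> X" "y \<in> Y" for x y
  proof
    assume "node_eq a b c x y"
    moreover have "node_eq a b c a x" "node_eq a b c y b" "x \<in> \<Omega>" "y \<in> \<Omega>"
      using xy N.eqv_sym A N.abc_in by (auto simp: X_def Y_def)
    ultimately have "node_eq a b c a b" using N.eqv_trans N.abc_in by metis
    then show False using N.base_not_eqv by blast
  qed
  have D: "D (f a) (f x) (f b) (f y)" if xy: "x \<in> X" "y \<in> Y" for x y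
  proof -
    have "x \<in> \<Omega>" "y \<in> \<Omega>" using xy XYA A by auto
    moreover have "node_eq a b c a x" using xy by (simp add: X_def)
    ultimately have "D a x b y"
      using N.eqv_D[of a x b y] notXY XYA xy N.abc_in by blast
    then show ?thesis using f xy XYA by blast
  qed
  have fin: "finite (f ` X)" "finite (f ` Y)" "f ` X \<subseteq> \<Omega>" "f ` Y \<subseteq> \<Omega>" "f a \<in> f ` X" "f b \<in> f ` Y"
    using A XYA finite_subset by auto
  obtain v where v: "v \<in> \<Omega>" "\<And>x. x \<in> f ` X \<Longrightarrow> D (f a) x v (f b)" "\<And>y. y \<in> f ` Y \<Longrightarrow> D (f b) y v (f a)"
    using dense_edge_point[OF dense fin(1,3,2,4,5,6)] D by blast
  have in\<Omega>: "f a \<in> \<Omega>" "f b \<in> \<Omega>" using fin by auto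
  have "D (f a) (f a) v (f b)" "D (f b) (f b) v (f a)" using v fin by auto
  then have "f a \<noteq> f b" "f a \<noteq> v" "f b \<noteq> v"
    using D_disjoint[of "f a" "f a" v "f b"] D_disjoint[of "f b" "f b" v "f a"] v in\<Omega> by auto
  then have N': "D_node \<Omega> D (f a) (f b) v" using D_node_intro in\<Omega> v by blast
  interpret N': D_node \<Omega> D "f a" "f b" v by fact
  let ?eq' = "node_eq (f a) (f b) v"
  have X': "?eq' (f a) (f x)" if x: "x \<in> X" for x
  proof -
    have "f x \<in> \<Omega>" "D (f a) (f x) v (f b)" using x v fin by auto
    then show ?thesis using N'.eqv_base(1) in\<Omega> v(1) by (simp add: D_comm)
  qed
  have Y': "?eq' (f b) (f y)" if y: "y \<in> Y" for y
  proof -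
    have "f y \<in> \<Omega>" "D (f b) (f y) v (f a)" using y v fin by auto
    then show ?thesis using N'.eqv_base(2) in\<Omega> v(1) by (simp add: D_comm)
  qed
  have AO: "x \<in> \<Omega>" "f x \<in> \<Omega>" if "x \<in> A" for x using A that by auto
  have side: "node_eq a b c s x \<and> ?eq' (f s) (f x)" if "s = a \<and> x \<in> X \<or> s = b \<and> x \<in> Y" for s x
    using X' Y' that by (auto simp: X_def Y_def)
  have same: "node_eq a b c x y \<and> ?eq' (f x) (f y)"
    if xy: "x \<in> A" "y \<in> A" "s \<in> A" "node_eq a b c s x" "node_eq a b c s y" "?eq' (f s) (f x)" "?eq' (f s) (f y)" for s x y
    using N.eqv_trans[of x s y] N.eqv_sym[of s x] N'.eqv_trans[of "f x" "f s" "f y"] N'.eqv_sym[of "f s" "f x"]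
      AO xy by blast
  have diff: "\<not> ?eq' (f x) (f y)" if xy: "x \<in> X" "y \<in> Y" for x y
  proof
    assume *: "?eq' (f x) (f y)"
    have i: "f x \<in> \<Omega>" "f y \<in> \<Omega>" using xy fin by auto
    then have "?eq' (f a) (f y)" using N'.eqv_trans X'[OF xy(1)] in\<Omega> * by blast
    then have "?eq' (f a) (f b)" using N'.eqv_trans N'.eqv_sym Y'[OF xy(2)] in\<Omega> i by blast
    then show False using N'.base_not_eqv by blast
  qed
  have iff: "?eq' (f x) (f y) \<longleftrightarrow> node_eq a b c x y" if xy: "x \<in> A" "y \<in> A" for x y
  proof -
    consider "x \<in> X" "y \<in> X" | "x \<in> Y" "y \<in> Y" | "x \<in> X" "y \<in> Y" | "x \<in> Y" "y \<in> X"
      using xy XYA by blast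
    then show ?thesis
    proof cases
      case 1
      then show ?thesis using same[OF xy ab(1)] side[of a x] side[of a y] by simp
    next
      case 2
      then show ?thesis using same[OF xy ab(2)] side[of b x] side[of b y] by simp
    next
      case 3
      then show ?thesis using notXY diff by simp
    next
      case 4
      then show ?thesis using notXY[of y x] diff[of y x] N.eqv_sym[of x y] N'.eqv_sym[of "f x" "f y"] AO xy by blast
    qed
  qed
  have new: "\<not> ?eq' v (f x)" if x: "x \<in> A" for x
  proof
    assume *: "?eq' v (f x)"
    then have **: "?eq' (f x) v" using N'.eqv_sym[OF v(1) AO(2)[OF x]] by blast
    have "?eq' (f a) (f x) \<or> ?eq' (f b) (f x)" using X' Y' XYA x by blast
    then have "?eq' (f a) v \<or> ?eq' (f b) v" using N'.eqv_trans ** AO[OF x] in\<Omega> v(1) by blast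
    then show False using N'.base_not_eqv by blast
  qed
  show thesis using that[OF N' iff new] by blast
qed

text \<open>The case of a branching point of the tree spanned by \<open>A\<close>: the points
  \<open>a\<close>, \<open>b\<close>, \<open>e\<close> in three of its directions already determine
  it, so its counterpart is the branching point of \<open>f a\<close>, \<open>f b\<close>,
  \<open>f e\<close>.\<close>

lemma (in D_set) ex_matching_node_branch:
  assumes regular: "regular_D \<Omega> D" and A: "finite A" "A \<subseteq> \<Omega>" "f ` A \<subseteq> \<Omega>"
    and f: "\<And>w x y z. \<lbrakk>w \<in> A; x \<in> A; y \<in> A; z \<in> A\<rbrakk> \<Longrightarrow> D (f w) (f x) (f y) (f z) \<longleftrightarrow> D w x y z"
    and N: "D_node \<Omega> D a b c" and new: "\<And>x. x \<in> A \<Longrightarrow> \<not> node_eq a b c c x"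
    and abe: "a \<in> A" "b \<in> A" "e \<in> A" "\<not> node_eq a b c a e" "\<not> node_eq a b c b e"
  obtains d where "d \<in> \<Omega>" "D_node \<Omega> D (f a) (f b) (f e)"
    "\<And>x y. \<lbrakk>x \<in> A; y \<in> A\<rbrakk> \<Longrightarrow> node_eq (f a) (f b) (f e) (f x) (f y) \<longleftrightarrow> node_eq a b c x y"
    "\<And>x. x \<in> A \<Longrightarrow> \<not> node_eq (f a) (f b) (f e) d (f x)"
proof -
  interpret N: D_node \<Omega> D a b c by fact
  have AO: "x \<in> \<Omega>" "f x \<in> \<Omega>" if "x \<in> A" for x using A that by auto
  have neq: "a \<noteq> b" "a \<noteq> e" "b \<noteq> e" using N.a_neq_b abe N.eqv_refl N.abc_in by auto
  have feq: "f x = f y \<longleftrightarrow> x = y" if "x \<in> A" "y \<in> A" for x y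
    using f[of x x y y] D_disjoint[of "f x" "f x" "f y" "f y"] D4[of x x y] that AO by auto
  then have N': "D_node \<Omega> D (f a) (f b) (f e)" using D_node_intro AO abe neq by simp
  interpret N': D_node \<Omega> D "f a" "f b" "f e" by fact
  let ?eq' = "node_eq (f a) (f b) (f e)"
  have iff: "?eq' (f x) (f y) \<longleftrightarrow> node_eq a b c x y" if xy: "x \<in> A" "y \<in> A" for x y
  proof -
    have "?eq' (f x) (f y) \<longleftrightarrow> node_eq a b e x y" using f xy abe by (simp add: node_eq_def)
    then show ?thesis
      using N.eqv_change_base[of a b e x y] N.base_not_eqv(1) AO xy abe by simp
  qed
  let ?cl = "node_class a b c" and ?cl' = "node_class (f a) (f b) (f e)"
  \<comment> \<open>If the image of \<open>A\<close> met every direction at the new node, that node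
    would have no more directions than \<open>A\<close> meets at the old one; but \<open>A\<close>
    misses the direction of \<open>c\<close> there, so the counts would differ, against
    regularity.\<close>
  have "\<exists>d\<in>\<Omega>. \<forall>x\<in>A. \<not> ?eq' d (f x)"
  proof (rule ccontr)
    assume "\<not> ?thesis"
    then have all: "\<exists>x\<in>A. ?eq' d (f x)" if "d \<in> \<Omega>" for d using that by blast
    have "?cl' ` \<Omega> \<subseteq> ?cl' ` f ` A"
    proof
      fix S assume "S \<in> ?cl' ` \<Omega>"
      then obtain d where d: "d \<in> \<Omega>" "S = ?cl' d" by blast
      obtain x where x: "x \<in> A" "?eq' d (f x)" using all d by blast
      have "?cl' d = ?cl' (f x)" using N'.class_eq_iff d x AO by blast
      then show "S \<in> ?cl' ` f ` A" using d x by blast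
    qed
    then have sub: "?cl' ` \<Omega> \<subseteq> (?cl' \<circ> f) ` A" by (simp add: image_comp)
    \<comment> \<open>A class met by \<open>A\<close> is sent to the class of the image of a chosen
      representative in \<open>A\<close>; by \<open>iff\<close> the choice does not matter.\<close>
    define h where "h S = ?cl' (f (SOME x. x \<in> A \<and> ?cl x = S))" for S
    have "?cl' (f x) = h (?cl x)" if x: "x \<in> A" for x
    proof -
      let ?y = "SOME y. y \<in> A \<and> ?cl y = ?cl x"
      have y: "?y \<in> A \<and> ?cl ?y = ?cl x" by (rule someI[of _ x]) (use x in simp)
      then have "node_eq a b c x ?y" using N.class_eq_iff[of x ?y] AO x by simp
      then have "?eq' (f x) (f ?y)" using iff x y by blast
      then show ?thesis using N'.class_eq_iff[of "f x" "f ?y"] AO x y by (simp add: h_def)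
    qed
    then have sub': "?cl' ` \<Omega> \<subseteq> h ` ?cl ` A" using sub by (auto simp: image_image)
    have finA: "finite (?cl ` A)" using A by simp
    have "finite (?cl' ` \<Omega>)" using finite_subset[OF sub'] finA by blast
    moreover have "?cl ` \<Omega> \<approx> ?cl' ` \<Omega>"
      using regular N.node_splitting_classes N'.node_splitting_classes unfolding regular_D_def by blast
    ultimately have fin: "finite (?cl ` \<Omega>)" and card1: "card (?cl ` \<Omega>) = card (?cl' ` \<Omega>)"
      using eqpoll_finite_iff eqpoll_iff_card by blast+
    have card2: "card (?cl' ` \<Omega>) \<le> card (?cl ` A)"
      using card_mono[OF _ sub'] card_image_le[OF finA, of h] finA by simp
    have "?cl ` A \<subset> ?cl ` \<Omega>"
    proof
      show "?cl ` A \<subseteq> ?cl ` \<Omega>" using A by blast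
      have "?cl c \<notin> ?cl ` A" using new N.class_eq_iff[of c] AO N.abc_in by auto
      then show "?cl ` A \<noteq> ?cl ` \<Omega>" using N.abc_in by blast
    qed
    then have "card (?cl ` A) < card (?cl ` \<Omega>)" by (rule psubset_card_mono[OF fin])
    then show False using card1 card2 by simp
  qed
  then obtain d where d: "d \<in> \<Omega>" "\<And>x. x \<in> A \<Longrightarrow> \<not> ?eq' d (f x)" by blast
  show thesis using that[OF d(1) N' iff d(2)] by blast
qed

section \<open>One-point extensions and back and forth\<close>

context proper_colored_D_set
begin

lemma one_point_extension:
  assumes dense: "dense_D \<Omega> D" and regular: "regular_D \<Omega> D"
    and colors: "\<And>\<S> S i. \<lbrakk>splitting \<Omega> D \<S>; S \<in> \<S>; infinite S; i \<in> {1..n}\<rbrakk> \<Longrightarrow> S \<inter> P i \<noteq> {}"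
    and A: "finite A" "A \<subseteq> \<Omega>" "f ` A \<subseteq> \<Omega>"
    and f: "\<And>w x y z. \<lbrakk>w \<in> A; x \<in> A; y \<in> A; z \<in> A\<rbrakk> \<Longrightarrow> D (f w) (f x) (f y) (f z) \<longleftrightarrow> D w x y z"
    and c: "c \<in> \<Omega>" "c \<notin> A"
  shows "\<exists>d\<in>\<Omega>. same_color c d \<and> d \<notin> f ` A \<and>
    (\<forall>x\<in>A. \<forall>y\<in>A. \<forall>z\<in>A. D c x y z \<longleftrightarrow> D d (f x) (f y) (f z))"
proof -
  \<comment> \<open>Every direction at a branching point is an infinite sector, so it contains the
    color of \<open>c\<close>.\<close>
  have color_in_class: "\<exists>d'\<in>node_class p q r d. same_color c d'"
    if N: "D_node \<Omega> D p q r" and d: "d \<in> \<Omega>" for p q r d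
  proof -
    obtain i where i: "i \<in> {1..n}" "c \<in> P i" using ex_color c by blast
    have "node_class p q r d \<inter> P i \<noteq> {}"
      using colors D_node.node_splitting_classes[OF N] node_class_infinite[OF N d] i d
      unfolding node_splitting_def by blast
    then show ?thesis using same_colorI i by blast
  qed
  have AO: "x \<in> \<Omega>" "f x \<in> \<Omega>" if "x \<in> A" for x using A that by auto
  consider "A = {}" | a where "A = {a}" | a b where "a \<in> A" "b \<in> A" "a \<noteq> b" by blast
  then show ?thesis
  proof cases
    case 1
    then show ?thesis using c by (auto simp: same_color_def)
  next
    \<comment> \<open>With one point, any \<open>d \<noteq> f a\<close> of the right color works; a
      direction avoiding \<open>f a\<close> provides it.\<close>
    case (2 a)
    have fa: "f a \<in> \<Omega>" using AO 2 by blast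
    then obtain y z where yz: "y \<in> \<Omega>" "z \<in> \<Omega>" "y \<noteq> f a" "z \<noteq> f a" "y \<noteq> z"
      using obtain_distinct_triple by blast
    then have N: "D_node \<Omega> D (f a) y z" using D_node_intro fa by metis
    interpret N: D_node \<Omega> D "f a" y z by fact
    obtain d where d: "d \<in> node_class (f a) y z y" "same_color c d" using color_in_class[OF N yz(1)] by blast
    have "d \<in> \<Omega>" using d by (simp add: node_class_def)
    moreover have "d \<noteq> f a" using d N.base_not_eqv(1) N.eqv_sym[of y "f a"] yz fa by (auto simp: node_class_def)
    moreover have "\<not> D c a a a" "\<not> D d (f a) (f a) (f a)"
      using D_disjoint[of c a a a] D_disjoint[of d "f a" "f a" "f a"] c fa AO 2 \<open>d \<in> \<Omega>\<close> by auto
    ultimately show ?thesis using d 2 by auto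
  next
    case (3 a b0)
    obtain b where b: "b \<in> A" "a \<noteq> b" "cone a b c \<inter> A = {}"
      using ex_cone_avoiding[OF A(1,2) 3 c(1)] by blast
    have N: "D_node \<Omega> D a b c" using D_node_intro[of a b c] AO 3 b c by blast
    interpret N: D_node \<Omega> D a b c by fact
    have new: "\<not> node_eq a b c c x" if "x \<in> A" for x
      using N.eqv_base(3)[of x] b(3) AO that by (auto simp: cone_def)
    \<comment> \<open>\<open>d\<close> lies in a direction missed by the image of \<open>A\<close>,
      at a node that sees this image as the node of \<open>a\<close>, \<open>b\<close>,
      \<open>c\<close> sees \<open>A\<close>. Whether \<open>A\<close> meets a third direction
      decides between regularity and density.\<close>
    have "\<exists>p q r d. d \<in> \<Omega> \<and> D_node \<Omega> D p q r \<and>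
      (\<forall>x\<in>A. \<forall>y\<in>A. node_eq p q r (f x) (f y) \<longleftrightarrow> node_eq a b c x y) \<and> (\<forall>x\<in>A. \<not> node_eq p q r d (f x))"
    proof (cases "\<exists>e\<in>A. \<not> node_eq a b c a e \<and> \<not> node_eq a b c b e")
      case True
      then obtain e where e: "e \<in> A" "\<not> node_eq a b c a e" "\<not> node_eq a b c b e" by blast
      show ?thesis
        by (rule ex_matching_node_branch[OF regular A f N new 3(1) b(1) e]) blast+
    next
      case False
      obtain d where d: "D_node \<Omega> D (f a) (f b) d"
        "\<And>x y. \<lbrakk>x \<in> A; y \<in> A\<rbrakk> \<Longrightarrow> node_eq (f a) (f b) d (f x) (f y) \<longleftrightarrow> node_eq a b c x y"
        "\<And>x. x \<in> A \<Longrightarrow> \<not> node_eq (f a) (f b) d d (f x)"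
        using ex_matching_node_edge[OF dense A f N 3(1) b(1)] False by blast
      have "d \<in> \<Omega>" using D_node.c_in[OF d(1)] .
      then show ?thesis using d by blast
    qed
    then obtain p q r d0 where d0: "d0 \<in> \<Omega>" and N': "D_node \<Omega> D p q r"
      and iff: "\<And>x y. \<lbrakk>x \<in> A; y \<in> A\<rbrakk> \<Longrightarrow> node_eq p q r (f x) (f y) \<longleftrightarrow> node_eq a b c x y"
      and new0: "\<And>x. x \<in> A \<Longrightarrow> \<not> node_eq p q r d0 (f x)" by blast
    interpret N': D_node \<Omega> D p q r by fact
    \<comment> \<open>Moving \<open>d0\<close> within its direction keeps that direction free of the
      image of \<open>A\<close>, so the color can be adjusted.\<close>
    obtain d where d: "d \<in> \<Omega>" "node_eq p q r d0 d" "same_color c d"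
      using color_in_class[OF N' d0] by (auto simp: node_class_def)
    have new': "\<not> node_eq p q r d (f x)" if "x \<in> A" for x
      using new0[OF that] N'.eqv_trans[of d0 d "f x"] d d0 AO that by blast
    have "d \<notin> f ` A" using new' N'.eqv_refl[OF d(1)] by auto
    moreover have "D c x y z \<longleftrightarrow> D d (f x) (f y) (f z)" if xyz: "x \<in> A" "y \<in> A" "z \<in> A" for x y z
    proof -
      \<comment> \<open>\<open>D_new_direction_iff\<close> requires a reference point of
        \<open>A\<close> outside the direction of \<open>x\<close>; \<open>a\<close> or
        \<open>b\<close> is one.\<close>
      obtain e where e: "e \<in> A" "\<not> node_eq a b c e x"
      proof (cases "node_eq a b c a x")
        case True
        have "\<not> node_eq a b c b x"
          using True N.eqv_trans[of a x b] N.eqv_sym[of b x] N.base_not_eqv(1) N.abc_in AO xyz by blast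
        then show ?thesis using that b(1) by blast
      qed (use that 3(1) in blast)
      have "D c x y z \<longleftrightarrow> node_eq a b c y z \<and> (node_eq a b c x y \<longrightarrow> D e x y z)"
        using N.D_new_direction_iff[of c x y z e] c new e AO xyz by blast
      moreover have "D d (f x) (f y) (f z) \<longleftrightarrow>
          node_eq p q r (f y) (f z) \<and> (node_eq p q r (f x) (f y) \<longrightarrow> D (f e) (f x) (f y) (f z))"
      proof -
        have "\<not> node_eq p q r (f e) (f x)" using iff[of e x] e xyz by simp
        then show ?thesis
          using N'.D_new_direction_iff[of d "f x" "f y" "f z" "f e"] d(1) new' e(1) AO xyz by simp
      qed
      ultimately show ?thesis using iff f e(1) xyz by simp
    qed
    ultimately show ?thesis using d by blast
  qed
qed

lemma part_iso_extend:
  assumes "dense_D \<Omega> D" "regular_D \<Omega> D"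
    and "\<And>\<S> S i. \<lbrakk>splitting \<Omega> D \<S>; S \<in> \<S>; infinite S; i \<in> {1..n}\<rbrakk> \<Longrightarrow> S \<inter> P i \<noteq> {}"
    and F: "part_iso F" and c: "c \<in> \<Omega>"
  shows "\<exists>d\<in>\<Omega>. part_iso (insert (c, d) F)"
proof (cases "c \<in> Domain F")
  case True
  then obtain d where "(c, d) \<in> F" by blast
  then show ?thesis using F part_isoD(3)[OF F] by (metis insert_absorb)
next
  case False
  define f where "f x = (SOME x'. (x, x') \<in> F)" for x
  have f: "(x, f x) \<in> F" if "x \<in> Domain F" for x
    unfolding f_def using that someI_ex[of "\<lambda>x'. (x, x') \<in> F"] by blast
  have F_eq: "x \<in> Domain F \<and> x' = f x" if "(x, x') \<in> F" for x x'
    using part_iso_eq_iff[OF F that f[of x]] that by blast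
  have img: "f ` Domain F = Range F" using f F_eq by blast
  have "\<exists>d\<in>\<Omega>. same_color c d \<and> d \<notin> f ` Domain F \<and>
    (\<forall>x\<in>Domain F. \<forall>y\<in>Domain F. \<forall>z\<in>Domain F. D c x y z \<longleftrightarrow> D d (f x) (f y) (f z))"
  proof (rule one_point_extension[OF assms(1-3)])
    show "finite (Domain F)" using part_isoD(4)[OF F] finite_Domain by blast
    show "Domain F \<subseteq> \<Omega>" "f ` Domain F \<subseteq> \<Omega>" using part_isoD(3)[OF F] img by blast+
    show "D (f w) (f x) (f y) (f z) \<longleftrightarrow> D w x y z"
      if "w \<in> Domain F" "x \<in> Domain F" "y \<in> Domain F" "z \<in> Domain F" for w x y z
      using part_isoD(1)[OF F f[OF that(1)] f[OF that(2)] f[OF that(3)] f[OF that(4)]] by simp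
  qed (use c False in auto)
  then obtain d where d: "d \<in> \<Omega>" "same_color c d" "d \<notin> Range F"
    and ext: "\<And>x y z. \<lbrakk>x \<in> Domain F; y \<in> Domain F; z \<in> Domain F\<rbrakk> \<Longrightarrow> D c x y z \<longleftrightarrow> D d (f x) (f y) (f z)"
    unfolding img by blast
  have "part_iso (insert (c, d) F)"
  proof (rule part_iso_insert[OF F c d(1,2) False d(3)])
    fix x x' y y' z z' assume "(x, x') \<in> F" "(y, y') \<in> F" "(z, z') \<in> F"
    then show "D c x y z \<longleftrightarrow> D d x' y' z'" using F_eq ext by metis
  qed
  then show ?thesis using d by blast
qed

lemma ultrahomogeneous_if:
  assumes "countable \<Omega>" "dense_D \<Omega> D" "regular_D \<Omega> D"
    and "\<And>\<S> S i. \<lbrakk>splitting \<Omega> D \<S>; S \<in> \<S>; infinite S; i \<in> {1..n}\<rbrakk> \<Longrightarrow> S \<inter> P i \<noteq> {}"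
  shows "ultrahomogeneous \<Omega> D n P"
  unfolding ultrahomogeneous_def
proof (intro allI impI, elim conjE)
  fix A B f assume A: "A \<subseteq> \<Omega>" "B \<subseteq> \<Omega>" "finite A" "finite B" and iso: "colored_D_iso D n P A B f"
  define F0 where "F0 = (\<lambda>x. (x, f x)) ` A"
  have "part_iso F0"
  proof -
    have "f ` A = B" using iso by (simp add: colored_D_iso_def bij_betw_def)
    then have "F0 \<subseteq> \<Omega> \<times> \<Omega>" "finite F0" using A by (auto simp: F0_def)
    then show ?thesis
      using iso unfolding part_iso_def colored_D_iso_def same_color_def by (auto simp: F0_def)
  qed
  have ne: "\<Omega> \<noteq> {}" using assms(2) by (auto simp: dense_D_def at_least_def)
  have extend: "\<exists>d\<in>\<Omega>. part_iso (insert (x, d) F)" if "part_iso F" "x \<in> \<Omega>" for F x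
    by (rule part_iso_extend[OF assms(2,3) _ that]) (fact assms(4))
  obtain R where R: "F0 \<subseteq> R" "\<Omega> \<subseteq> Domain R" "\<Omega> \<subseteq> Range R"
    "\<And>G. \<lbrakk>finite G; G \<subseteq> R\<rbrakk> \<Longrightarrow> \<exists>F. G \<subseteq> F \<and> part_iso F"
  proof (rule back_and_forth[of \<Omega> \<Omega> part_iso F0])
    show "\<exists>y\<in>\<Omega>. part_iso (insert (x, y) F)" if "part_iso F" "x \<in> \<Omega>" for F x
      using extend that by blast
    show "\<exists>x\<in>\<Omega>. part_iso (insert (x, y) F)" if F: "part_iso F" "y \<in> \<Omega>" for F y
    proof -
      \<comment> \<open>Going back for \<open>F\<close> is going forth for its converse.\<close>
      obtain x where x: "x \<in> \<Omega>" "part_iso (insert (y, x) (F\<inverse>))"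
        using extend[OF part_iso_converse[OF F(1)] F(2)] by blast
      have "(insert (y, x) (F\<inverse>))\<inverse> = insert (x, y) F" by auto
      then show ?thesis using part_iso_converse[OF x(2)] x(1) by auto
    qed
  qed (use assms(1) ne \<open>part_iso F0\<close> in auto)
  define g where "g x = (SOME x'. (x, x') \<in> R)" for x
  have g: "(x, g x) \<in> R" if "x \<in> \<Omega>" for x
    unfolding g_def using that R(2) someI_ex[of "\<lambda>x'. (x, x') \<in> R"] by blast
  have RO: "x \<in> \<Omega> \<and> x' \<in> \<Omega> \<and> same_color x x'" if xx': "(x, x') \<in> R" for x x'
  proof -
    obtain F where "(x, x') \<in> F" "part_iso F" using R(4)[of "{(x, x')}"] xx' by auto
    then show ?thesis using part_isoD(2,3)[of F x x'] by simp
  qed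
  have R_eq: "x = y \<longleftrightarrow> x' = y'" if xy: "(x, x') \<in> R" "(y, y') \<in> R" for x x' y y'
  proof -
    obtain F where "(x, x') \<in> F" "(y, y') \<in> F" "part_iso F"
      using R(4)[of "{(x, x'), (y, y')}"] xy by auto
    then show ?thesis using part_iso_eq_iff[of F x x' y y'] by simp
  qed
  have gD: "D (g w) (g x) (g y) (g z) \<longleftrightarrow> D w x y z"
    if wxyz: "w \<in> \<Omega>" "x \<in> \<Omega>" "y \<in> \<Omega>" "z \<in> \<Omega>" for w x y z
  proof -
    let ?G = "{(w, g w), (x, g x), (y, g y), (z, g z)}"
    obtain F where "?G \<subseteq> F" "part_iso F" using R(4)[of ?G] g wxyz by auto
    then show ?thesis using part_isoD(1)[of F w "g w" x "g x" y "g y" z "g z"] by simp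
  qed
  have "bij_betw g \<Omega> \<Omega>"
  proof (rule bij_betw_imageI)
    show "inj_on g \<Omega>" using R_eq[OF g g] by (simp add: inj_on_def)
    have "y \<in> g ` \<Omega>" if y: "y \<in> \<Omega>" for y
    proof -
      obtain x where x: "(x, y) \<in> R" using R(3) y by blast
      then have "x \<in> \<Omega>" "g x = y" using RO[OF x] R_eq[OF g x] by auto
      then show ?thesis by blast
    qed
    then show "g ` \<Omega> = \<Omega>" using g RO by blast
  qed
  then have "colored_D_iso D n P \<Omega> \<Omega> g"
    unfolding colored_D_iso_def using gD RO[OF g] by (simp add: same_color_def)
  moreover have "g x = f x" if x: "x \<in> A" for x
  proof -
    have "(x, f x) \<in> R" "x \<in> \<Omega>" using R(1) x A by (auto simp: F0_def)
    then show ?thesis using R_eq[OF g[of x], of x "f x"] by simp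
  qed
  ultimately show "\<exists>g. colored_D_iso D n P \<Omega> \<Omega> g \<and> (\<forall>x\<in>A. g x = f x)" by blast
qed

end

section \<open>Consequences of ultrahomogeneity\<close>

text \<open>For points of one sector, two of \<open>a\<close>, \<open>b\<close>, \<open>c\<close>
  lie outside it and the separation condition of \<open>splitting\<close> applies; for points
  \<open>u\<close>, \<open>v\<close> of different sectors, \<open>D p q u v\<close> fails whenever
  \<open>p\<close>, \<open>q\<close> also come from different sectors.\<close>

lemma (in D_set) splitting_node_eq_iff:
  assumes S: "splitting \<Omega> D \<S>" and sec: "A \<in> \<S>" "B \<in> \<S>" "C \<in> \<S>" "A \<noteq> B" "A \<noteq> C" "B \<noteq> C"
    and abc: "a \<in> A" "b \<in> B" "c \<in> C" and UV: "U \<in> \<S>" "V \<in> \<S>" "u \<in> U" "v \<in> V"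
  shows "node_eq a b c u v \<longleftrightarrow> U = V"
proof -
  have part: "partition_on \<Omega> \<S>" using S by (simp add: splitting_def)
  have in\<Omega>: "x \<in> \<Omega>" if "X \<in> \<S>" "x \<in> X" for X x using partition_onD1[OF part] that by blast
  have disj: "x \<notin> X" if "X \<in> \<S>" "Y \<in> \<S>" "X \<noteq> Y" "x \<in> Y" for X Y x
    using partition_onD2[OF part] that by (auto simp: disjoint_def)
  have near: "D x y z t" if "X \<in> \<S>" "x \<in> X" "y \<in> X" "z \<in> \<Omega>" "z \<notin> X" "t \<in> \<Omega>" "t \<notin> X" for X x y z t
    using S that unfolding splitting_def by blast
  have far: "\<not> D p q u v" if pq: "X \<in> \<S>" "Y \<in> \<S>" "X \<noteq> Y" "p \<in> X" "q \<in> Y" and "U \<noteq> V" for X Y p q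
  proof
    assume D: "D p q u v"
    have i: "p \<in> \<Omega>" "q \<in> \<Omega>" "u \<in> \<Omega>" "v \<in> \<Omega>" using in\<Omega> pq UV by blast+
    \<comment> \<open>If \<open>u\<close> or \<open>v\<close> shares the sector of \<open>p\<close>
      or \<open>q\<close>, separation yields a pairing that excludes \<open>D p q u v\<close>;
      otherwise four sectors are involved and the condition on distinct sectors applies.\<close>
    have sep: False
      if X': "X' \<in> \<S>" "Y' \<in> \<S>" "X' \<noteq> Y'" "s \<in> X'" "r \<in> Y'" "u' \<in> X'" "v' \<notin> X'" "v' \<in> \<Omega>" "D s r u' v'" for X' Y' s r u' v'
    proof -
      have j: "s \<in> \<Omega>" "r \<in> \<Omega>" "u' \<in> \<Omega>" using in\<Omega> X' by blast+
      have "r \<notin> X'" using disj X' by blast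
      then have "D s u' r v'" using near X' j by blast
      then show False using D_exclusive[of s r u' v'] X' j by blast
    qed
    have D': "D q p u v" "D p q v u" "D q p v u" using D i by (simp_all add: D_comm)
    have nm: "v \<notin> U" "u \<notin> V" using disj UV \<open>U \<noteq> V\<close> by blast+
    consider "U = X" | "U = Y" | "V = X" | "V = Y" | "distinct [X, Y, U, V]"
      using pq(3) \<open>U \<noteq> V\<close> by auto
    then show False
    proof cases
      case 1 then show False using sep[of X Y p q u v] pq UV nm i D by blast
    next
      case 2 then show False using sep[of Y X q p u v] pq UV nm i D' by blast
    next
      case 3 then show False using sep[of X Y p q v u] pq UV nm i D' by blast
    next
      case 4 then show False using sep[of Y X q p v u] pq UV nm i D' by blast
    next
      case 5
      have "\<forall>A\<in>\<S>. \<forall>B\<in>\<S>. \<forall>C\<in>\<S>. \<forall>E\<in>\<S>. distinct [A, B, C, E] \<longrightarrow>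
          (\<forall>a\<in>A. \<forall>b\<in>B. \<forall>c\<in>C. \<forall>d\<in>E. \<not> D a b c d)"
        using S by (simp add: splitting_def)
      then have "\<forall>a\<in>X. \<forall>b\<in>Y. \<forall>c\<in>U. \<forall>d\<in>V. \<not> D a b c d" using 5 pq(1,2) UV(1,2) by meson
      then show False using D pq(4,5) UV(3,4) by meson
    qed
  qed
  show ?thesis
  proof
    show "U = V" if "node_eq a b c u v"
      using that far[OF sec(1,2,4) abc(1,2)] far[OF sec(1,3,5) abc(1,3)] far[OF sec(2,3,6) abc(2,3)]
      unfolding node_eq_def by blast
    assume "U = V"
    have i: "a \<in> \<Omega>" "b \<in> \<Omega>" "c \<in> \<Omega>" "u \<in> \<Omega>" "v \<in> \<Omega>" using in\<Omega> sec abc UV by blast+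
    have *: "D p q u v" if "p \<notin> U" "q \<notin> U" "p \<in> \<Omega>" "q \<in> \<Omega>" for p q
      using near[of U u v p q] UV \<open>U = V\<close> that i by (simp add: D_comm)
    have "a \<notin> U \<or> b \<notin> U" "a \<notin> U \<or> c \<notin> U" "b \<notin> U \<or> c \<notin> U"
      using disj[OF UV(1)] sec abc by blast+
    then show "node_eq a b c u v" using * i unfolding node_eq_def by blast
  qed
qed

text \<open>The three sectors and the points in them are arbitrary, so the base points of a node
  splitting can later be chosen with prescribed colors.\<close>

lemma (in D_set) node_splitting_eq_classes:
  assumes S: "splitting \<Omega> D \<S>" and sec: "A \<in> \<S>" "B \<in> \<S>" "C \<in> \<S>" "A \<noteq> B" "A \<noteq> C" "B \<noteq> C"
    and abc: "a \<in> A" "b \<in> B" "c \<in> C"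
  shows "D_node \<Omega> D a b c" "\<S> = node_class a b c ` \<Omega>"
proof -
  have part: "partition_on \<Omega> \<S>" using S by (simp add: splitting_def)
  have U: "\<Union>\<S> = \<Omega>" using partition_onD1[OF part] by simp
  have cls: "node_class a b c u = T" if T: "T \<in> \<S>" "u \<in> T" for T u
  proof -
    have "node_eq a b c u v \<longleftrightarrow> v \<in> T" if v: "v \<in> \<Omega>" for v
    proof -
      obtain V where V: "V \<in> \<S>" "v \<in> V" using U v by blast
      then have "v \<in> T \<longleftrightarrow> T = V" using partition_onD2[OF part] T by (auto simp: disjoint_def)
      then show ?thesis using splitting_node_eq_iff[OF S sec abc T(1) V(1) T(2) V(2)] by blast
    qed
    then show ?thesis using U T by (auto simp: node_class_def)
  qed
  show "\<S> = node_class a b c ` \<Omega>"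
  proof
    show "\<S> \<subseteq> node_class a b c ` \<Omega>"
    proof
      fix T assume T: "T \<in> \<S>"
      then obtain u where u: "u \<in> T" using partition_onD3[OF part] by (metis equals0I)
      have "u \<in> \<Omega>" using U T u by blast
      then show "T \<in> node_class a b c ` \<Omega>" using cls[OF T u] by blast
    qed
    show "node_class a b c ` \<Omega> \<subseteq> \<S>"
    proof
      fix T assume "T \<in> node_class a b c ` \<Omega>"
      then obtain u where u: "u \<in> \<Omega>" "T = node_class a b c u" by blast
      then obtain V where "V \<in> \<S>" "u \<in> V" using U by blast
      then show "T \<in> \<S>" using cls u by metis
    qed
  qed
  have "a \<noteq> b" "a \<noteq> c" "b \<noteq> c" using partition_onD2[OF part] sec abc by (auto simp: disjoint_def)
  moreover have "a \<in> \<Omega>" "b \<in> \<Omega>" "c \<in> \<Omega>" using U sec abc by blast+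
  ultimately show "D_node \<Omega> D a b c" using D_node_intro by blast
qed

section \<open>Automorphisms extending small partial isomorphisms, and what they force\<close>

context proper_colored_D_set
begin

text \<open>\<open>D\<close> carries no information on three distinct points, so equal colors
  suffice: the last condition of \<open>part_iso_insert\<close> is vacuous at each step.\<close>

lemma part_iso_triple:
  assumes "a \<in> \<Omega>" "b \<in> \<Omega>" "c \<in> \<Omega>" "a' \<in> \<Omega>" "b' \<in> \<Omega>" "c' \<in> \<Omega>"
    and "a \<noteq> b" "a \<noteq> c" "b \<noteq> c" "a' \<noteq> b'" "a' \<noteq> c'" "b' \<noteq> c'"
    and "same_color a a'" "same_color b b'" "same_color c c'"
  shows "part_iso {(c, c'), (b, b'), (a, a')}"
proof -
  have "part_iso {}" by (simp add: part_iso_def)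
  then have "part_iso {(a, a')}" by (rule part_iso_insert) (use assms in auto)
  then have "part_iso {(b, b'), (a, a')}" by (rule part_iso_insert) (use assms in auto)
  then show ?thesis by (rule part_iso_insert) (use assms in auto)
qed

text \<open>On four distinct points at most one of the three pairings holds, so knowing a pairing
  that does settles every instance of \<open>D\<close>.\<close>

lemma part_iso_quadruple:
  assumes "w \<in> \<Omega>" "x \<in> \<Omega>" "y \<in> \<Omega>" "z \<in> \<Omega>" "w' \<in> \<Omega>" "x' \<in> \<Omega>" "y' \<in> \<Omega>" "z' \<in> \<Omega>"
    and D: "D w x y z" "D w' x' y' z'" and neq: "w \<noteq> x" "y \<noteq> z" "w' \<noteq> x'" "y' \<noteq> z'"
    and col: "same_color w w'" "same_color x x'" "same_color y y'" "same_color z z'"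
  shows "part_iso {(z, z'), (y, y'), (x, x'), (w, w')}"
proof -
  have d: "w \<noteq> y" "w \<noteq> z" "x \<noteq> y" "x \<noteq> z" "w' \<noteq> y'" "w' \<noteq> z'" "x' \<noteq> y'" "x' \<noteq> z'"
    using D_disjoint[of w x y z] D_disjoint[of w' x' y' z'] assms by auto
  have pos: "D z y w x" "D z y x w" "D z' y' w' x'" "D z' y' x' w'"
    using D assms(1-8) by (simp_all add: D_comm)
  have neg: "\<not> D z w x y" "\<not> D z w y x" "\<not> D z x w y" "\<not> D z x y w"
    using D_exclusive[of z y w x] D_exclusive[of z y x w] pos assms(1-8) by (simp_all add: D_swap_right)
  have neg': "\<not> D z' w' x' y'" "\<not> D z' w' y' x'" "\<not> D z' x' w' y'" "\<not> D z' x' y' w'"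
    using D_exclusive[of z' y' w' x'] D_exclusive[of z' y' x' w'] pos assms(1-8) by (simp_all add: D_swap_right)
  have "part_iso {(y, y'), (x, x'), (w, w')}" by (rule part_iso_triple) (use assms(1-8) d neq col in auto)
  then show ?thesis
    by (rule part_iso_insert) (use assms(1-8) d neq col pos neg neg' in auto)
qed

lemma ultrahomogeneous_part_iso:
  assumes uh: "ultrahomogeneous \<Omega> D n P" and F: "part_iso F"
  obtains g where "bij_betw g \<Omega> \<Omega>" "\<And>x x'. (x, x') \<in> F \<Longrightarrow> g x = x'"
    "\<And>w x y z. \<lbrakk>w \<in> \<Omega>; x \<in> \<Omega>; y \<in> \<Omega>; z \<in> \<Omega>\<rbrakk> \<Longrightarrow> D (g w) (g x) (g y) (g z) \<longleftrightarrow> D w x y z"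
    "\<And>i x. \<lbrakk>i \<in> {1..n}; x \<in> \<Omega>\<rbrakk> \<Longrightarrow> g x \<in> P i \<longleftrightarrow> x \<in> P i"
proof -
  define f where "f x = (SOME x'. (x, x') \<in> F)" for x
  have f: "(x, f x) \<in> F" if "x \<in> Domain F" for x
    unfolding f_def using that someI_ex[of "\<lambda>x'. (x, x') \<in> F"] by blast
  have F_eq: "f x = x'" if "(x, x') \<in> F" for x x'
    using part_iso_eq_iff[OF F that f[of x]] that by blast
  have "colored_D_iso D n P (Domain F) (Range F) f"
    unfolding colored_D_iso_def
  proof (intro conjI)
    show "bij_betw f (Domain F) (Range F)"
    proof (rule bij_betw_imageI)
      show "inj_on f (Domain F)" using part_iso_eq_iff[OF F f f] by (simp add: inj_on_def)
      show "f ` Domain F = Range F" using f F_eq by force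
    qed
    show "\<forall>w\<in>Domain F. \<forall>x\<in>Domain F. \<forall>y\<in>Domain F. \<forall>z\<in>Domain F. D (f w) (f x) (f y) (f z) \<longleftrightarrow> D w x y z"
      using part_isoD(1)[OF F f f f f] by simp
    show "\<forall>i\<in>{1..n}. \<forall>x\<in>Domain F. f x \<in> P i \<longleftrightarrow> x \<in> P i"
      using part_isoD(2)[OF F f] by (simp add: same_color_def)
  qed
  moreover have "Domain F \<subseteq> \<Omega>" "Range F \<subseteq> \<Omega>" "finite (Domain F)" "finite (Range F)"
    using part_isoD(3,4)[OF F] finite_Domain finite_Range by blast+
  ultimately obtain g where g: "colored_D_iso D n P \<Omega> \<Omega> g" "\<forall>x\<in>Domain F. g x = f x"
    using uh unfolding ultrahomogeneous_def by blast
  show thesis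
  proof
    show "bij_betw g \<Omega> \<Omega>" using g by (simp add: colored_D_iso_def)
    show "g x = x'" if "(x, x') \<in> F" for x x' using g(2) F_eq[OF that] that by auto
  qed (use g(1) in \<open>auto simp: colored_D_iso_def\<close>)
qed

text \<open>If an infinite sector avoids a color, then among its subcones pointing away from a point of
  that color some cone shares its set of colors with all smaller ones; it contains three points of
  one color, two of which cannot be exchanged.\<close>

lemma sector_meets_color:
  assumes uh: "ultrahomogeneous \<Omega> D n P" and S: "splitting \<Omega> D \<S>" "S \<in> \<S>"
    and inf: "infinite S" and i: "i \<in> {1..n}"
  shows "S \<inter> P i \<noteq> {}"
proof
  assume disj: "S \<inter> P i = {}"
  have S\<Omega>: "S \<subseteq> \<Omega>" using S partition_onD1[of \<Omega> \<S>] by (auto simp: splitting_def)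
  have P\<Omega>: "P i \<subseteq> \<Omega>" using colors_cover i by blast
  obtain p where p: "p \<in> P i" "p \<in> \<Omega> - S" using colors_nonempty[OF i] disj P\<Omega> by blast
  define cols where "cols T = {k \<in> {1..n}. T \<inter> P k \<noteq> {}}" for T
  obtain a0 where a0: "a0 \<in> S" using inf infinite_imp_nonempty by blast
  have "infinite (S - {a0})" using inf by simp
  then obtain b0 where b0: "b0 \<in> S - {a0}" using infinite_imp_nonempty by blast
  \<comment> \<open>Over pairs of distinct points of \<open>S\<close>, a \<open>cone p a b\<close>
    with fewest colors is taken; every \<open>cone p u v\<close> with distinct \<open>u\<close>,
    \<open>v\<close> in it then has exactly the same colors.\<close>
  let ?Q = "\<lambda>(a, b). a \<in> S \<and> b \<in> S \<and> a \<noteq> b"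
  let ?m = "\<lambda>(a, b). card (cols (cone p a b))"
  have "?Q (a0, b0)" using a0 b0 by auto
  then obtain ab where "?Q ab" "\<forall>y. ?Q y \<longrightarrow> ?m ab \<le> ?m y"
    using ex_has_least_nat[of ?Q "(a0, b0)" ?m] by blast
  then obtain a b where ab: "a \<in> S" "b \<in> S" "a \<noteq> b"
    and least: "\<And>a' b'. \<lbrakk>a' \<in> S; b' \<in> S; a' \<noteq> b'\<rbrakk> \<Longrightarrow> card (cols (cone p a b)) \<le> card (cols (cone p a' b'))"
    by (cases ab) auto
  let ?T = "cone p a b"
  have abO: "a \<in> \<Omega>" "b \<in> \<Omega>" "p \<in> \<Omega>" "p \<noteq> a" "p \<noteq> b" using ab S\<Omega> p by auto
  have TS: "?T \<subseteq> S" using cone_sub_sector S ab p by blast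
  have sub: "cone p u v \<subseteq> ?T" "u \<notin> cone p u v" "infinite (cone p u v)" "cols (cone p u v) = cols ?T"
    if uv: "u \<in> ?T" "v \<in> ?T" "u \<noteq> v" for u v
  proof -
    have uvS: "u \<in> S" "v \<in> S" using uv TS by blast+
    then have uvO: "u \<in> \<Omega>" "v \<in> \<Omega>" "p \<noteq> u" "p \<noteq> v" using S\<Omega> p by auto
    show 1: "cone p u v \<subseteq> ?T" and "u \<notin> cone p u v" using subcone uv abO by blast+
    show "infinite (cone p u v)" using cone_infinite uvO uv abO by blast
    have fin: "finite (cols ?T)" by (simp add: cols_def)
    have "cols (cone p u v) \<subseteq> cols ?T" using 1 by (auto simp: cols_def)
    then show "cols (cone p u v) = cols ?T" using card_seteq[OF fin] least[OF uvS uv(3)] by blast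
  qed
  \<comment> \<open>The color of \<open>b\<close> occurs in all these subcones, which gives
    \<open>b1\<close> and then \<open>c1\<close> of this color in nested cones, with
    \<open>D p b b1 c1\<close>.\<close>
  obtain j where j: "j \<in> {1..n}" "b \<in> P j" using ex_color abO by blast
  have bT: "b \<in> ?T" using cone_self abO ab by blast
  then have jT: "j \<in> cols ?T" using j by (auto simp: cols_def)
  have next_pt: "\<exists>e\<in>T. e \<noteq> u" if "infinite T" for T and u :: 'a
  proof -
    have "infinite (T - {u})" using that by simp
    then show ?thesis using infinite_imp_nonempty by blast
  qed
  have "infinite ?T" using cone_infinite abO ab by blast
  then obtain c0 where c0: "c0 \<in> ?T" "c0 \<noteq> b" using next_pt by blast
  let ?T1 = "cone p b c0"
  have bc0: "b \<noteq> c0" using c0 by simp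
  note T1 = sub[OF bT c0(1) bc0]
  have "j \<in> cols ?T1" using jT T1(4) by simp
  then obtain b1 where b1: "b1 \<in> ?T1" "b1 \<in> P j" by (auto simp: cols_def)
  obtain c' where c': "c' \<in> ?T1" "c' \<noteq> b1" using next_pt[OF T1(3)] by blast
  have "b1 \<in> ?T" "c' \<in> ?T" "b1 \<noteq> c'" using b1 c' T1(1) by auto
  note T2 = sub[OF this]
  have "j \<in> cols (cone p b1 c')" using jT T2(4) by simp
  then obtain c1 where c1: "c1 \<in> cone p b1 c'" "c1 \<in> P j" by (auto simp: cols_def)
  have c0O: "c0 \<in> \<Omega>" using c0 by (simp add: cone_def)
  have c1T1: "c1 \<in> ?T1" using subcone(1)[of p b c0 b1 c'] b1 c' c1 abO c0O by blast
  have neq: "b \<noteq> b1" "b \<noteq> c1" "b1 \<noteq> c1" using T1(2) T2(2) b1 c1 c1T1 by auto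
  have inS: "b1 \<in> S" "c1 \<in> S" using b1 c1T1 T1(1) TS by blast+
  then have O: "b1 \<in> \<Omega>" "c1 \<in> \<Omega>" using S\<Omega> by auto
  have D1: "D p b b1 c1" using cone_D[of p b c0 b1 c1] b1 c1T1 abO c0O by blast
  \<comment> \<open>The three points have one color, so exchanging \<open>b\<close> and
    \<open>b1\<close> while fixing \<open>c1\<close> extends to an automorphism.\<close>
  have iso: "part_iso {(c1, c1), (b1, b), (b, b1)}"
    by (rule part_iso_triple) (use neq O abO same_colorI[OF j(1)] j b1 c1 in auto)
  obtain g where g: "bij_betw g \<Omega> \<Omega>"
    "\<And>x x'. (x, x') \<in> {(c1, c1), (b1, b), (b, b1)} \<Longrightarrow> g x = x'"
    "\<And>w x y z. \<lbrakk>w \<in> \<Omega>; x \<in> \<Omega>; y \<in> \<Omega>; z \<in> \<Omega>\<rbrakk> \<Longrightarrow> D (g w) (g x) (g y) (g z) \<longleftrightarrow> D w x y z"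
    "\<And>i x. \<lbrakk>i \<in> {1..n}; x \<in> \<Omega>\<rbrakk> \<Longrightarrow> g x \<in> P i \<longleftrightarrow> x \<in> P i"
    by (fact ultrahomogeneous_part_iso[OF uh iso])
  have gb: "g b = b1" "g b1 = b" "g c1 = c1" using g(2) by auto
  let ?q = "g p"
  \<comment> \<open>Being of color \<open>i\<close>, the image of \<open>p\<close> also lies outside
    \<open>S\<close>. Hence \<open>D p b b1 c1\<close> gives \<open>D (g p) b b1 c1\<close>, whereas
    \<open>g\<close> turns it into the incompatible \<open>D (g p) b1 b c1\<close>.\<close>
  have "?q \<in> P i" using g(4)[OF i abO(3)] p by blast
  then have q: "?q \<in> \<Omega> - S" using disj P\<Omega> by blast
  have D2: "D ?q b1 b c1" using g(3)[of p b b1 c1] D1 gb abO O by simp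
  have "D b b1 p ?q" using S ab inS p q unfolding splitting_def by blast
  then have "\<not> D p b b1 ?q" using D_exclusive[of b b1 p ?q] abO O q by (simp add: D_comm)
  then have "D ?q b b1 c1" using D3[OF _ _ _ _ D1] abO O q by blast
  then show False using D_exclusive[of ?q b b1 c1] D2 abO O q by blast
qed

lemma cone_meets_color:
  assumes uh: "ultrahomogeneous \<Omega> D n P" and abc: "a \<in> \<Omega>" "b \<in> \<Omega>" "c \<in> \<Omega>" "a \<noteq> b" "a \<noteq> c" "b \<noteq> c"
    and i: "i \<in> {1..n}"
  shows "cone a b c \<inter> P i \<noteq> {}"
proof -
  have N: "D_node \<Omega> D a b c" using D_node_intro abc by blast
  interpret N: D_node \<Omega> D a b c by fact
  have "cone a b c = node_class a b c c" using N.eqv_base(3) by (auto simp: cone_def node_class_def)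
  moreover have "splitting \<Omega> D (node_class a b c ` \<Omega>)"
    using N.node_splitting_classes by (simp add: node_splitting_def)
  ultimately show ?thesis
    using sector_meets_color[OF uh _ _ cone_infinite[OF abc] i] abc(3) by blast
qed

lemma ultrahomogeneous_imp_regular:
  assumes uh: "ultrahomogeneous \<Omega> D n P"
  shows "regular_D \<Omega> D"
  unfolding regular_D_def
proof (intro allI impI, elim conjE)
  fix \<S> \<T> assume ST: "node_splitting \<Omega> D \<S>" "node_splitting \<Omega> D \<T>"
  have "\<Omega> \<noteq> {}" using three_points by (auto simp: at_least_def)
  \<comment> \<open>Any one color will do for all base points, since every infinite sector meets
    it.\<close>
  then obtain i where i: "i \<in> {1..n}" using ex_color by blast
  have base: "\<exists>a b c. a \<in> P i \<and> b \<in> P i \<and> c \<in> P i \<and> D_node \<Omega> D a b c \<and> \<S> = node_class a b c ` \<Omega>"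
    if "node_splitting \<Omega> D \<S>" for \<S>
  proof -
    have S: "splitting \<Omega> D \<S>" "at_least 3 \<S>" using that by (auto simp: node_splitting_def)
    have part: "partition_on \<Omega> \<S>" using S by (simp add: splitting_def)
    have "\<exists>T\<subseteq>\<S>. card T = 3"
      using S(2) infinite_arbitrarily_large obtain_subset_with_card_n unfolding at_least_def by metis
    then obtain T where T: "T \<subseteq> \<S>" "card T = 3" by blast
    then obtain A B C where "T = {A, B, C}" "A \<noteq> B" "A \<noteq> C" "B \<noteq> C"
      by (auto simp: card_3_iff)
    then have sec: "A \<in> \<S>" "B \<in> \<S>" "C \<in> \<S>" "A \<noteq> B" "A \<noteq> C" "B \<noteq> C" using T(1) by auto
    have "A \<noteq> {}" "B \<noteq> {}" "C \<noteq> {}" using partition_onD3[OF part] sec by auto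
    then obtain a b c where "a \<in> A" "b \<in> B" "c \<in> C" by blast
    note cl = node_splitting_eq_classes[OF S(1) sec this]
    have "infinite X" if "X \<in> \<S>" for X using node_class_infinite[OF cl(1)] that unfolding cl(2) by blast
    then have "A \<inter> P i \<noteq> {}" "B \<inter> P i \<noteq> {}" "C \<inter> P i \<noteq> {}"
      using sector_meets_color[OF uh S(1)] sec i by blast+
    then obtain a' b' c' where abc: "a' \<in> A" "b' \<in> B" "c' \<in> C" "a' \<in> P i" "b' \<in> P i" "c' \<in> P i" by blast
    then show ?thesis using node_splitting_eq_classes[OF S(1) sec abc(1-3)] by blast
  qed
  obtain a b c where abc: "a \<in> P i" "b \<in> P i" "c \<in> P i" "D_node \<Omega> D a b c" "\<S> = node_class a b c ` \<Omega>"
    using base[OF ST(1)] by blast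
  obtain a' b' c' where abc': "a' \<in> P i" "b' \<in> P i" "c' \<in> P i" "D_node \<Omega> D a' b' c'" "\<T> = node_class a' b' c' ` \<Omega>"
    using base[OF ST(2)] by blast
  interpret N: D_node \<Omega> D a b c by fact
  interpret N': D_node \<Omega> D a' b' c' by fact
  have iso: "part_iso {(c, c'), (b, b'), (a, a')}"
    by (rule part_iso_triple)
      (use N.abc_in N'.abc_in N.a_neq_b N.a_neq_c N.b_neq_c N'.a_neq_b N'.a_neq_c N'.b_neq_c
        same_colorI[OF i] abc(1-3) abc'(1-3) in auto)
  obtain g where g: "bij_betw g \<Omega> \<Omega>"
    "\<And>x x'. (x, x') \<in> {(c, c'), (b, b'), (a, a')} \<Longrightarrow> g x = x'"
    "\<And>w x y z. \<lbrakk>w \<in> \<Omega>; x \<in> \<Omega>; y \<in> \<Omega>; z \<in> \<Omega>\<rbrakk> \<Longrightarrow> D (g w) (g x) (g y) (g z) \<longleftrightarrow> D w x y z"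
    "\<And>i x. \<lbrakk>i \<in> {1..n}; x \<in> \<Omega>\<rbrakk> \<Longrightarrow> g x \<in> P i \<longleftrightarrow> x \<in> P i"
    by (fact ultrahomogeneous_part_iso[OF uh iso])
  have gabc: "g a = a'" "g b = b'" "g c = c'" using g(2) by auto
  have inj: "inj_on g \<Omega>" and img: "g ` \<Omega> = \<Omega>" using g(1) by (auto simp: bij_betw_def)
  \<comment> \<open>\<open>node_eq\<close> is written in terms of \<open>D\<close> and the base
    points, so \<open>g\<close> carries directions to directions, and thereby \<open>\<S>\<close>
    bijectively onto \<open>\<T>\<close>.\<close>
  have iff: "node_eq a' b' c' (g u) (g v) \<longleftrightarrow> node_eq a b c u v" if "u \<in> \<Omega>" "v \<in> \<Omega>" for u v
    using g(3)[of a b u v] g(3)[of a c u v] g(3)[of b c u v] that N.abc_in gabc by (simp add: node_eq_def)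
  have cls: "g ` node_class a b c u = node_class a' b' c' (g u)" if u: "u \<in> \<Omega>" for u
  proof -
    have "node_class a' b' c' (g u) = {v \<in> g ` \<Omega>. node_eq a' b' c' (g u) v}"
      by (simp add: img node_class_def)
    also have "\<dots> = g ` {v \<in> \<Omega>. node_eq a' b' c' (g u) (g v)}" by blast
    also have "{v \<in> \<Omega>. node_eq a' b' c' (g u) (g v)} = node_class a b c u"
      using iff u by (auto simp: node_class_def)
    finally show ?thesis by simp
  qed
  have "\<T> = node_class a' b' c' ` g ` \<Omega>" using abc'(5) img by simp
  also have "\<dots> = (`) g ` \<S>" unfolding abc(5) image_image using cls by simp
  finally have "(`) g ` \<S> = \<T>" by simp
  moreover have "inj_on ((`) g) \<S>"
  proof (rule inj_on_image)
    have "\<Union>\<S> \<subseteq> \<Omega>" unfolding abc(5) by (auto simp: node_class_def)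
    then show "inj_on g (\<Union>\<S>)" using inj inj_on_subset by blast
  qed
  ultimately show "\<S> \<approx> \<T>" unfolding eqpoll_def bij_betw_def by blast
qed

lemma ultrahomogeneous_imp_dense:
  assumes uh: "ultrahomogeneous \<Omega> D n P"
  shows "dense_D \<Omega> D"
proof -
  have "\<exists>v\<in>\<Omega>. D v x y z \<and> D w v y z \<and> D w x v z \<and> D w x y v"
    if O: "w \<in> \<Omega>" "x \<in> \<Omega>" "y \<in> \<Omega>" "z \<in> \<Omega>" and D: "D w x y z" for w x y z
  proof -
    have d: "w \<noteq> y" "w \<noteq> z" "x \<noteq> y" "x \<noteq> z" using D_disjoint[OF O D] by auto
    \<comment> \<open>D5 for \<open>t\<close>, \<open>r\<close>, \<open>s\<close> doubles the point
      \<open>s\<close>; this settles the cases where just one of the two pairs is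
      degenerate.\<close>
    have half: "\<exists>v\<in>\<Omega>. v \<noteq> s \<and> v \<noteq> t \<and> v \<noteq> r \<and> D s v t r"
      if str: "s \<in> \<Omega>" "t \<in> \<Omega>" "r \<in> \<Omega>" "s \<noteq> t" "s \<noteq> r" "t \<noteq> r" for s t r
    proof -
      obtain v where v: "v \<in> \<Omega>" "v \<noteq> s" "D t r s v" using D5[of t r s] str by blast
      then have "v \<noteq> t" "v \<noteq> r" using D_disjoint[of t r s v] str by auto
      moreover have "D s v t r" using v str by (simp add: D_comm)
      ultimately show ?thesis using v by blast
    qed
    consider "w = x" "y = z" | "w = x" "y \<noteq> z" | "w \<noteq> x" "y = z" | "w \<noteq> x" "y \<noteq> z" by blast
    then show ?thesis
    proof cases
      case 1
      obtain u v where "u \<in> \<Omega>" "v \<in> \<Omega>" "u \<noteq> w" "v \<noteq> w" "u \<noteq> v"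
        using obtain_distinct_triple[OF O(1)] by blast
      then obtain v where v: "v \<in> \<Omega>" "v \<noteq> w" "v \<noteq> y" by metis
      then have "D v w y y" "D w v y y" "D w w v y" "D w w y v"
        using D4[of v w y] D4[of w v y] D_degenerate[of v y w] D_degenerate[of y v w] O d by auto
      then show ?thesis using v 1 by blast
    next
      case 2
      obtain v where v: "v \<in> \<Omega>" "v \<noteq> w" "v \<noteq> y" "v \<noteq> z" "D w v y z"
        using half[of w y z] O d 2 by auto
      have "D v w y z" using v O D_swap_left[of w v y z] by blast
      moreover have "D w w v z" "D w w y v" using D_degenerate[of v z w] D_degenerate[of y v w] v O d by auto
      ultimately show ?thesis using v 2 by blast
    next
      case 3
      obtain v where v: "v \<in> \<Omega>" "v \<noteq> w" "v \<noteq> x" "v \<noteq> y" "D y v w x"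
        using half[of y w x] O d 3 by auto
      have "D w x y v" "D w x v y" using v O by (simp_all add: D_comm)
      moreover have "D v x y y" "D w v y y" using D4[of v x y] D4[of w v y] v O d by auto
      ultimately show ?thesis using v 3 by blast
    next
      case 4
      note wx = 4(1) and yz = 4(2)
      \<comment> \<open>In the direction \<open>?T\<close> of \<open>w\<close> from the branching
        point of \<open>x\<close>, \<open>y\<close>, \<open>w\<close>, points \<open>w'\<close>,
        \<open>x'\<close> with the colors of \<open>w\<close>, \<open>x\<close> are chosen; then
        \<open>x\<close> itself branches off between \<open>w'\<close>, \<open>x'\<close> and
        \<open>y\<close>, \<open>z\<close>.\<close>
      let ?T = "cone x y w"
      obtain i k where i: "i \<in> {1..n}" "w \<in> P i" and k: "k \<in> {1..n}" "x \<in> P k" using ex_color O by metis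
      have "?T \<inter> P i \<noteq> {}" using cone_meets_color[OF uh, of x y w i] O d wx i by auto
      then obtain w' where w': "w' \<in> ?T" "w' \<in> P i" by blast
      have "infinite ?T" using cone_infinite[of x y w] O d wx by auto
      then have "infinite (?T - {w'})" by simp
      then obtain e where e: "e \<in> ?T" "e \<noteq> w'" using infinite_imp_nonempty by blast
      have out: "u \<in> \<Omega>" "u \<noteq> x" if "u \<in> ?T" for u
        using that D_disjoint[of x y w u] O by (auto simp: cone_def)
      \<comment> \<open>\<open>cone x w' e\<close> avoids \<open>w'\<close>, which makes
        \<open>x'\<close> distinct from \<open>w'\<close>.\<close>
      have "cone x w' e \<inter> P k \<noteq> {}"
        using cone_meets_color[OF uh, of x w' e k] out w' e O k by auto
      then obtain x' where x': "x' \<in> cone x w' e" "x' \<in> P k" by blast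
      have x'T: "x' \<in> ?T" and "x' \<noteq> w'" using subcone[of x y w w' e] O w' e x' by blast+
      have O': "w' \<in> \<Omega>" "x' \<in> \<Omega>" using out w' x'T by blast+
      have near: "D u x y z" if u: "u \<in> ?T" for u
      proof -
        have "D x y w u" "u \<in> \<Omega>" using u by (auto simp: cone_def)
        then have "\<not> D w x y u" using D_exclusive[of x y w u] O by (simp add: D_comm)
        then show ?thesis using D_insert_left[of w x y z u] O D \<open>u \<in> \<Omega>\<close> by blast
      qed
      have D1: "D w' x y z" "D x' x y z" using near w' x'T by blast+
      have D2: "D w' x' x y" using cone_D[of x y w w' x'] w' x'T O O' by (simp add: D_comm)
      have D3: "D w' x' y z" using D_trans[of y z w' x x'] D1 O O' by (simp add: D_comm)
      have D4: "D w' x' x z" using D_trans[of w' x' x y z] D2 D3 O O' by blast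
      have col: "same_color w' w" "same_color x' x" "same_color y y" "same_color z z"
        using same_colorI[OF i(1) w'(2) i(2)] same_colorI[OF k(1) x'(2) k(2)] by (simp_all add: same_color_def)
      \<comment> \<open>Moving \<open>w'\<close>, \<open>x'\<close> to \<open>w\<close>,
        \<open>x\<close> with \<open>y\<close>, \<open>z\<close> fixed carries \<open>x\<close> to
        the point \<open>g x\<close> required by density.\<close>
      have iso: "part_iso {(z, z), (y, y), (x', x), (w', w)}"
        using part_iso_quadruple[OF O'(1,2) O(3,4) O D3 D _ yz wx yz col] \<open>x' \<noteq> w'\<close> by blast
      obtain g where g: "bij_betw g \<Omega> \<Omega>"
        "\<And>s s'. (s, s') \<in> {(z, z), (y, y), (x', x), (w', w)} \<Longrightarrow> g s = s'"
        "\<And>w x y z. \<lbrakk>w \<in> \<Omega>; x \<in> \<Omega>; y \<in> \<Omega>; z \<in> \<Omega>\<rbrakk> \<Longrightarrow> D (g w) (g x) (g y) (g z) \<longleftrightarrow> D w x y z"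
        "\<And>i x. \<lbrakk>i \<in> {1..n}; x \<in> \<Omega>\<rbrakk> \<Longrightarrow> g x \<in> P i \<longleftrightarrow> x \<in> P i"
        by (fact ultrahomogeneous_part_iso[OF uh iso])
      have gs: "g z = z" "g y = y" "g x' = x" "g w' = w" using g(2) by auto
      have gx: "g x \<in> \<Omega>" using g(1) O by (auto simp: bij_betw_def)
      have "D (g x) x y z" using g(3)[of x x' y z] D1 O O' gs D_swap_left[of x x' y z] by simp
      moreover have "D w (g x) y z" using g(3)[of w' x y z] D1 O O' gs by simp
      moreover have "D w x (g x) z" using g(3)[of w' x' x z] D4 O O' gs by simp
      moreover have "D w x y (g x)" using g(3)[of w' x' y x] D2 O O' gs D_swap_right[of w' x' y x] by simp
      ultimately show ?thesis using gx by blast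
    qed
  qed
  moreover have "at_least 2 \<Omega>" using three_points by (auto simp: at_least_def)
  ultimately show ?thesis unfolding dense_D_def by blast
qed

end

theorem theorem1:
  fixes \<Omega> :: "'a set" and D :: "'a \<Rightarrow> 'a \<Rightarrow> 'a \<Rightarrow> 'a \<Rightarrow> bool"
    and n :: nat and P :: "nat \<Rightarrow> 'a set"
  assumes "countable \<Omega>"
    and "proper_D_set \<Omega> D"
    and "colored_D_set \<Omega> D n P"
  shows "ultrahomogeneous \<Omega> D n P \<longleftrightarrow>
    dense_D \<Omega> D \<and> regular_D \<Omega> D \<and>
    (\<forall>\<S> S i. splitting \<Omega> D \<S> \<and> S \<in> \<S> \<and> infinite S \<and> i \<in> {1..n} \<longrightarrow> S \<inter> P i \<noteq> {})"
proof -
  interpret proper_colored_D_set \<Omega> D n P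
    using assms(2,3) by (simp add: proper_colored_D_set_def)
  show ?thesis
  proof
    assume uh: "ultrahomogeneous \<Omega> D n P"
    then show "dense_D \<Omega> D \<and> regular_D \<Omega> D \<and>
      (\<forall>\<S> S i. splitting \<Omega> D \<S> \<and> S \<in> \<S> \<and> infinite S \<and> i \<in> {1..n} \<longrightarrow> S \<inter> P i \<noteq> {})"
      using ultrahomogeneous_imp_dense ultrahomogeneous_imp_regular sector_meets_color[OF uh] by metis
  next
    assume "dense_D \<Omega> D \<and> regular_D \<Omega> D \<and>
      (\<forall>\<S> S i. splitting \<Omega> D \<S> \<and> S \<in> \<S> \<and> infinite S \<and> i \<in> {1..n} \<longrightarrow> S \<inter> P i \<noteq> {})"
    then show "ultrahomogeneous \<Omega> D n P"
      by (intro ultrahomogeneous_if[OF assms(1)]) blast+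
  qed
qed

end
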